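(* Let $w>0$ be real. For all $\alpha,\beta>0$ with $\alpha\beta\le 1$, the optimal frame constants $A(\alpha,\beta;w)$ and $B(\alpha,\beta;w)$ of the Gabor system generated by the Cauchy kernel $g(t)=\frac{1}{t-iw}$ satisfy $$A(\alpha,\beta;w)\ \ge\ \frac{4\pi^2}{\alpha}\left(\frac{1}{e^{2\pi\beta w}+1}\right)^2,\qquad B(\alpha,\beta;w)\ \le\ \frac{4\pi^2}{\alpha}\left(\frac{e^{2\pi\beta w}}{e^{2\pi\beta w}-1}\right)^2 .$$
   Context: For $w>0$, $\alpha,\beta>0$ and $m,n\in\mathbb{Z}$ put $$g_{m,n}(t)=\frac{e^{2\pi i\beta n t}}{t-\alpha m-iw},\qquad t\in\mathbb{R}.$$ The inner product on $L^2(\mathbb{R})$ is $\langle f,g\rangle=\int_{\mathbb{R}} f(t)\overline{g(t)}\,dt$ and $\|\cdot\|$ is the corresponding norm. The optimal frame constants $A(\alpha,\beta;w)$ and $B(\alpha,\beta;w)$ are, respectively, the largest $A$ and the smallest $B$ such that $$A\|f\|^2\le\sum_{m,n\in\mathbb{Z}}|\langle f,g_{m,n}\rangle|^2\le B\|f\|^2\qquad\text{for all } f\in L^2(\mathbb{R}).$$ *)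

theory Defs
  imports "HOL-Analysis.Analysis"
begin

text \<open>
  \<open>L\<^sup>2(\<real>)\<close> is represented by Borel functions rather than by classes modulo null sets;
  every class has a Borel representative, and norm and inner product do not depend on it.
\<close>

definition L2 :: "(real \<Rightarrow> complex) set" where
  "L2 = {f. f \<in> borel_measurable lborel \<and> integrable lborel (\<lambda>t. (cmod (f t))\<^sup>2)}"

definition L2_inner :: "(real \<Rightarrow> complex) \<Rightarrow> (real \<Rightarrow> complex) \<Rightarrow> complex" where
  "L2_inner f g = (LINT t|lborel. f t * cnj (g t))"

definition L2_norm :: "(real \<Rightarrow> complex) \<Rightarrow> real" where
  "L2_norm f = sqrt (LINT t|lborel. (cmod (f t))\<^sup>2)"

text \<open>
  Frame bounds live in \<open>[0, \<infinity>]\<close>, and the sum of squares is taken there too, so the optimal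
  constants exist for every family: the upper one is \<open>\<infinity>\<close> if there is no finite upper bound,
  and the lower one is \<open>0\<close> if there is no positive lower bound.
\<close>

definition frame_sum :: "('i \<Rightarrow> real \<Rightarrow> complex) \<Rightarrow> (real \<Rightarrow> complex) \<Rightarrow> ennreal" where
  "frame_sum G f = (\<Sum>\<^sub>\<infinity>i\<in>UNIV. ennreal ((cmod (L2_inner f (G i)))\<^sup>2))"

definition lower_frame_bound :: "('i \<Rightarrow> real \<Rightarrow> complex) \<Rightarrow> ennreal \<Rightarrow> bool" where
  "lower_frame_bound G A \<longleftrightarrow> (\<forall>f\<in>L2. A * ennreal ((L2_norm f)\<^sup>2) \<le> frame_sum G f)"

definition upper_frame_bound :: "('i \<Rightarrow> real \<Rightarrow> complex) \<Rightarrow> ennreal \<Rightarrow> bool" where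
  "upper_frame_bound G B \<longleftrightarrow> (\<forall>f\<in>L2. frame_sum G f \<le> B * ennreal ((L2_norm f)\<^sup>2))"

definition optimal_lower_frame_const :: "('i \<Rightarrow> real \<Rightarrow> complex) \<Rightarrow> ennreal" where
  "optimal_lower_frame_const G = Sup {A. lower_frame_bound G A}"

definition optimal_upper_frame_const :: "('i \<Rightarrow> real \<Rightarrow> complex) \<Rightarrow> ennreal" where
  "optimal_upper_frame_const G = Inf {B. upper_frame_bound G B}"

text \<open>The supremum and the infimum are attained, so these are the largest and smallest bounds.\<close>

lemma lower_frame_bound_optimal: "lower_frame_bound G (optimal_lower_frame_const G)"
  unfolding lower_frame_bound_def
proof
  fix f assume f: "f \<in> L2"
  let ?S = "{A. lower_frame_bound G A}"
  have "Sup ?S * ennreal ((L2_norm f)\<^sup>2) = (SUP A\<in>?S. A * ennreal ((L2_norm f)\<^sup>2))"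
    using SUP_mult_right_ennreal[of "\<lambda>A. A" ?S "ennreal ((L2_norm f)\<^sup>2)"] by simp
  also have "\<dots> \<le> frame_sum G f"
    using f by (auto intro!: SUP_least simp: lower_frame_bound_def)
  finally show "optimal_lower_frame_const G * ennreal ((L2_norm f)\<^sup>2) \<le> frame_sum G f"
    by (simp add: optimal_lower_frame_const_def)
qed

lemma upper_frame_bound_optimal: "upper_frame_bound G (optimal_upper_frame_const G)"
  unfolding upper_frame_bound_def
proof
  fix f assume f: "f \<in> L2"
  let ?c = "ennreal ((L2_norm f)\<^sup>2)"
  show "frame_sum G f \<le> optimal_upper_frame_const G * ?c"
  proof (cases "L2_norm f = 0")
    case True
    have "AE t in lborel. f t = 0"
      using f True integral_nonneg_eq_0_iff_AE[of lborel "\<lambda>t. (cmod (f t))\<^sup>2"]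
      by (simp add: L2_def L2_norm_def)
    then have "L2_inner f h = 0" for h
      unfolding L2_inner_def by (intro integral_eq_zero_AE) auto
    then show ?thesis
      by (simp add: frame_sum_def)
  next
    case False
    then have c: "0 < ?c" by simp
    have "frame_sum G f / ?c \<le> optimal_upper_frame_const G"
      unfolding optimal_upper_frame_const_def
      using f c by (auto intro!: Inf_greatest divide_le_posI_ennreal simp: upper_frame_bound_def mult.commute)
    then have "frame_sum G f / ?c * ?c \<le> optimal_upper_frame_const G * ?c"
      by (rule mult_right_mono) simp
    then show ?thesis
      using c by (simp add: ennreal_divide_times ennreal_mult_divide_eq)
  qed
qed

definition gabor_system ::
  "(real \<Rightarrow> complex) \<Rightarrow> real \<Rightarrow> real \<Rightarrow> int \<times> int \<Rightarrow> real \<Rightarrow> complex" where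
  "gabor_system g \<alpha> \<beta> = (\<lambda>(m, n) t.
     exp (2 * of_real pi * \<i> * of_real \<beta> * of_int n * of_real t) * g (t - \<alpha> * of_int m))"

definition cauchy_kernel :: "real \<Rightarrow> real \<Rightarrow> complex" where
  "cauchy_kernel w t = 1 / (of_real t - \<i> * of_real w)"

lemma gabor_system_cauchy_kernel:
  "gabor_system (cauchy_kernel w) \<alpha> \<beta> (m, n) t =
     exp (2 * of_real pi * \<i> * of_real \<beta> * of_int n * of_real t) /
     (of_real t - of_real \<alpha> * of_int m - \<i> * of_real w)"
  by (simp add: gabor_system_def cauchy_kernel_def)

end

theory Submission
  imports Defs "HOL-Probability.Sinc_Integral"
begin

text \<open>
  For bounded \<open>f\<close> with bounded support, Parseval in \<open>n\<close> (period \<open>1/\<beta>\<close>) reduces the frame sum to the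
  fibres \<open>a\<^sub>k = f(t + k/\<beta>)\<close>: one has to compare \<open>\<Sum>\<^sub>m \<bar>\<Sum>\<^sub>k a\<^sub>k / (t + k/\<beta> - \<alpha>m + iw)\<bar>\<^sup>2\<close> with \<open>\<Sum>\<^sub>k \<bar>a\<^sub>k\<bar>\<^sup>2\<close>.
  Writing \<open>u\<^sub>k = t + k/\<beta> - \<alpha>m + iw\<close>, the integral of \<open>exp(2\<pi>ixu\<^sub>k)\<close> over \<open>[-\<beta>/2, \<beta>/2]\<close> is
  \<open>sin(\<pi>\<beta>u\<^sub>k) / (\<pi>u\<^sub>k)\<close>, and the sine depends on \<open>k\<close> only through a sign. Hence, up to a factor
  \<open>sin(\<pi>\<beta>(t - \<alpha>m + iw))\<close> of modulus between \<open>sinh(\<pi>\<beta>w)\<close> and \<open>cosh(\<pi>\<beta>w)\<close>, the inner sum is the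
  \<open>m\<close>-th Fourier coefficient, for the period \<open>1/\<alpha> \<ge> \<beta>\<close>, of a trigonometric polynomial times
  \<open>exp(-2\<pi>wx)\<close> on \<open>[-\<beta>/2, \<beta>/2]\<close>. A second use of Parseval gives the constants; truncation extends
  the bounds to all of \<open>L\<^sup>2\<close>.
\<close>

section \<open>Parseval's identity\<close>

inductive trig_poly :: "(real \<Rightarrow> complex) \<Rightarrow> bool" where
  monomial: "trig_poly (\<lambda>t. c * cis (2 * pi * of_int n * t))"
| add: "trig_poly p \<Longrightarrow> trig_poly q \<Longrightarrow> trig_poly (\<lambda>t. p t + q t)"

lemma trig_poly_const: "trig_poly (\<lambda>t. c)"
  using trig_poly.monomial[of c 0] by simp

lemma trig_poly_mult:
  assumes "trig_poly p" "trig_poly q"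
  shows "trig_poly (\<lambda>t. p t * q t)"
  using assms(1)
proof induction
  case (monomial c m)
  show ?case
    using assms(2)
  proof induction
    case (monomial d n)
    have "(\<lambda>t. c * cis (2 * pi * of_int m * t) * (d * cis (2 * pi * of_int n * t))) =
        (\<lambda>t. c * d * cis (2 * pi * of_int (m + n) * t))"
    proof
      fix t :: real
      have "cis (2 * pi * of_int (m + n) * t) = cis (2 * pi * of_int m * t) * cis (2 * pi * of_int n * t)"
        by (simp add: cis_mult algebra_simps)
      then show "c * cis (2 * pi * of_int m * t) * (d * cis (2 * pi * of_int n * t)) =
          c * d * cis (2 * pi * of_int (m + n) * t)"
        by simp
    qed
    then show ?case
      by (metis trig_poly.monomial)
  next
    case (add p q)
    then show ?case
      using trig_poly.add[of "\<lambda>t. c * cis (2 * pi * of_int m * t) * p t"] by (simp add: distrib_left)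
  qed
next
  case (add p1 p2)
  then show ?case
    using trig_poly.add[of "\<lambda>t. p1 t * q t" "\<lambda>t. p2 t * q t"] by (simp add: distrib_right)
qed

text \<open>On the unit circle both coordinates are combinations of \<open>cis\<close> at
  frequencies 1 and -1, and trigonometric polynomials are closed under sums and products. This
  carries polynomial approximation on the circle over to trigonometric polynomials.\<close>

lemma trig_poly_real_polynomial:
  fixes f :: "complex \<Rightarrow> real"
  assumes "real_polynomial_function f"
  shows "trig_poly (\<lambda>t. of_real (f (cis (2 * pi * t))))"
  using assms
proof induction
  case (linear f)
  interpret bounded_linear f by fact
  have f: "f z = Re z * f 1 + Im z * f \<i>" for z
  proof -
    have "z = Re z *\<^sub>R 1 + Im z *\<^sub>R \<i>" by (simp add: complex_eq_iff)
    then show ?thesis using add scaleR by (metis real_scaleR_def)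
  qed
  \<comment> \<open>By real linearity \<open>f\<close> at the angle s equals f(1) cos s + f(i) sin
    s; \<open>?a\<close> and \<open>?b\<close> are the coefficients of exp(is) and exp(-is) in this
    expression.\<close>
  let ?a = "(of_real (f 1) - \<i> * of_real (f \<i>)) / 2" and ?b = "(of_real (f 1) + \<i> * of_real (f \<i>)) / 2"
  have "(\<lambda>t. of_real (f (cis (2 * pi * t)))) =
      (\<lambda>t. ?a * cis (2 * pi * of_int 1 * t) + ?b * cis (2 * pi * of_int (- 1) * t))"
    by (rule ext, subst f) (simp add: complex_eq_iff field_simps)
  moreover have "trig_poly \<dots>"
    by (intro trig_poly.add trig_poly.monomial)
  ultimately show ?case
    by simp
qed (simp_all add: trig_poly_const trig_poly.add trig_poly_mult)

text \<open>The inductive form suits closure arguments, whereas Bessel's identity needs one finite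
  sum over distinct frequencies. Two such sums are merged over the union of their frequency sets,
  missing coefficients being 0.\<close>

lemma trig_poly_sum_form:
  assumes "trig_poly p"
  shows "\<exists>F c. finite F \<and> p = (\<lambda>t. \<Sum>n\<in>F. c n * cis (2 * pi * of_int n * t))"
  using assms
proof induction
  case (monomial c n)
  show ?case
    by (rule exI[of _ "{n}"], rule exI[of _ "\<lambda>_. c"]) simp
next
  case (add p q)
  then obtain F c G d where F: "finite F" "p = (\<lambda>t. \<Sum>n\<in>F. c n * cis (2 * pi * of_int n * t))"
    and G: "finite G" "q = (\<lambda>t. \<Sum>n\<in>G. d n * cis (2 * pi * of_int n * t))"
    by blast
  have "p t = (\<Sum>n\<in>F \<union> G. (if n \<in> F then c n else 0) * cis (2 * pi * of_int n * t))" for t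
    unfolding F(2) by (rule sum.mono_neutral_cong_left) (use F G in auto)
  moreover have "q t = (\<Sum>n\<in>F \<union> G. (if n \<in> G then d n else 0) * cis (2 * pi * of_int n * t))" for t
    unfolding G(2) by (rule sum.mono_neutral_cong_left) (use F G in auto)
  ultimately have "p t + q t = (\<Sum>n\<in>F \<union> G.
      ((if n \<in> F then c n else 0) + (if n \<in> G then d n else 0)) * cis (2 * pi * of_int n * t))" for t
    by (simp only: sum.distrib distrib_right)
  then show ?case
    using F(1) G(1)
    by (intro exI[of _ "F \<union> G"]
        exI[of _ "\<lambda>n. (if n \<in> F then c n else 0) + (if n \<in> G then d n else 0)"]) simp
qed

text \<open>Because the end values agree, \<open>q\<close> descends to a continuous function on the
  unit circle, where Stone-Weierstrass applies; the real and imaginary parts of the approximant are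
  real polynomials.\<close>

lemma trig_poly_approx_loop:
  fixes q :: "real \<Rightarrow> complex"
  assumes q: "continuous_on {0..1} q" "q 0 = q 1" and "e > 0"
  obtains p where "trig_poly p" "\<And>t. t \<in> {0..1} \<Longrightarrow> cmod (q t - p t) < e"
proof -
  let ?h = "q \<circ> (\<lambda>z. Arg2pi z / (2 * pi))"
  have "path q" "pathfinish q = pathstart q"
    using q by (auto simp: path_def pathfinish_def pathstart_def)
  \<comment> \<open>The trivial homotopy from \<open>q\<close> to itself is used only to extract
    continuity of the induced circle map \<open>?h\<close>.\<close>
  then have "homotopic_loops UNIV q q"
    by (simp add: homotopic_loops_refl)
  then have "continuous_on (sphere 0 1) ?h"
    by (metis homotopic_loops_imp_homotopic_circlemaps homotopic_with_imp_continuous)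
  then obtain g where g: "polynomial_function g" "\<And>z. z \<in> sphere 0 1 \<Longrightarrow> cmod (?h z - g z) < e"
    using Stone_Weierstrass_polynomial_function[of "sphere 0 1" ?h e] \<open>e > 0\<close> by auto
  have "real_polynomial_function (Re \<circ> g)" "real_polynomial_function (Im \<circ> g)"
    using g(1) by (auto simp: polynomial_function_def bounded_linear_Re bounded_linear_Im)
  then have "trig_poly (\<lambda>t. of_real ((Re \<circ> g) (cis (2 * pi * t))) + \<i> * of_real ((Im \<circ> g) (cis (2 * pi * t))))"
    by (intro trig_poly.add trig_poly_mult trig_poly_const trig_poly_real_polynomial)
  then have p: "trig_poly (\<lambda>t. g (cis (2 * pi * t)))"
    by (simp flip: complex_eq)
  \<comment> \<open>\<open>Arg2pi\<close> takes values in [0, 2 pi), so t = 1 is sent to the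
    parameter 0; there the equality rests on \<open>q 0 = q 1\<close>.\<close>
  have "?h (cis (2 * pi * t)) = q t" if "t \<in> {0..1}" for t
  proof (cases "t = 1")
    case True
    then have "cis (2 * pi * t) = 1" by simp
    then show ?thesis using True q(2) using Arg2pi_of_real[of 1] by simp
  next
    case False
    then have "Arg2pi (cis (2 * pi * t)) = 2 * pi * t"
      using that by (intro Arg2pi_unique[of 1]) (auto simp: cis_conv_exp mult_ac)
    then show ?thesis by simp
  qed
  then have "cmod (q t - g (cis (2 * pi * t))) < e" if "t \<in> {0..1}" for t
    using g(2)[of "cis (2 * pi * t)"] that by force
  with p show ?thesis
    by (rule that)
qed

section \<open>Orthonormal characters on the unit interval: Bessel's identity and density in the
  mean square\<close>

lemma integral_exp_atLeastAtMost:
  fixes c :: complex and a b :: real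
  assumes "a \<le> b" "c \<noteq> 0"
  shows "(LINT x|lborel. indicator {a..b} x *\<^sub>R exp (c * of_real x)) = (exp (c * of_real b) - exp (c * of_real a)) / c"
proof -
  have "(LINT x|lborel. indicator {a..b} x *\<^sub>R exp (c * of_real x)) =
      exp (c * of_real b) / c - exp (c * of_real a) / c"
  proof (rule integral_FTC_atLeastAtMost)
    show "((\<lambda>x. exp (c * of_real x) / c) has_vector_derivative exp (c * of_real x)) (at x within {a..b})" for x
      using assms(2)
      by (auto intro!: derivative_eq_intros has_vector_derivative_real_field
          [where f="\<lambda>z. exp (c * z) / c" and f'="exp (c * of_real x)", unfolded o_def])
  qed (use assms in \<open>auto intro!: continuous_intros\<close>)
  then show ?thesis
    by (simp add: diff_divide_distrib)
qed

abbreviation unit_interval :: "real measure" where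
  "unit_interval \<equiv> restrict_space lborel {0..1}"

lemma finite_measure_unit_interval: "finite_measure unit_interval"
proof (rule finite_measureI)
  have "emeasure unit_interval {0..1} = emeasure lborel {0..1::real}"
    by (rule emeasure_restrict_space) auto
  then show "emeasure unit_interval (space unit_interval) \<noteq> \<infinity>"
    by (simp add: space_restrict_space)
qed

lemma borel_measurable_unit_interval:
  fixes f :: "real \<Rightarrow> 'a::topological_space"
  assumes "f \<in> borel_measurable borel" shows "f \<in> borel_measurable unit_interval"
proof -
  have "f \<in> borel_measurable lborel" using assms by simp
  then show ?thesis by (rule measurable_restrict_space1)
qed

lemma integrable_unit_interval_bounded:
  fixes f :: "real \<Rightarrow> 'a::{banach, second_countable_topology}"
  assumes "f \<in> borel_measurable borel" "\<And>t. norm (f t) \<le> B"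
  shows "integrable unit_interval f"
proof -
  have "AE x in unit_interval. norm (f x) \<le> B" using assms(2) by (intro AE_I2)
  then show ?thesis
    by (rule finite_measure.integrable_const_bound[OF finite_measure_unit_interval _ borel_measurable_unit_interval[OF assms(1)]])
qed

lemma integral_unit_interval_cis:
  "(LINT t|unit_interval. cis (2 * pi * of_int n * t)) = (if n = 0 then 1 else 0)"
proof (cases "n = 0")
  case True
  then show ?thesis
    by (simp add: measure_restrict_space)
next
  case False
  let ?c = "2 * of_real pi * of_int n * \<i>"
  have e: "cis (2 * pi * of_int n * t) = exp (?c * of_real t)" for t
    by (simp add: cis_conv_exp mult_ac)
  have "(LINT t|unit_interval. cis (2 * pi * of_int n * t)) = (exp (?c * of_real 1) - exp (?c * of_real 0)) / ?c"
    using False integral_exp_atLeastAtMost[of 0 1 ?c]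
    by (simp add: integral_restrict_space e)
  also have "exp (?c * of_real 1) = 1"
    by (simp add: exp_eq_1 mult_ac)
  finally show ?thesis
    using False by simp
qed

lemma borel_measurable_cnj [measurable (raw)]:
  "f \<in> borel_measurable M \<Longrightarrow> (\<lambda>x. cnj (f x)) \<in> borel_measurable M"
  by (rule borel_measurable_continuous_on[of cnj]) (auto intro: continuous_intros)

text \<open>Expand the square, use orthonormality and complete the square in the \<open>c n\<close>.
  One identity serves three purposes: Bessel's inequality (\<open>c\<close> the Fourier
  coefficients), the reverse estimate (\<open>c\<close> from an approximant) and the norm of a
  trigonometric sum (\<open>v\<close> = 0).\<close>

lemma bessel_identity:
  fixes v :: "real \<Rightarrow> complex"
  assumes v[measurable]: "v \<in> borel_measurable borel" and bd: "\<And>t. cmod (v t) \<le> M" and "finite F"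
  shows "(LINT t|unit_interval. (cmod (v t - (\<Sum>n\<in>F. c n * cis (2 * pi * of_int n * t))))\<^sup>2) =
      (LINT t|unit_interval. (cmod (v t))\<^sup>2)
      - (\<Sum>n\<in>F. (cmod (LINT t|unit_interval. v t * cis (- (2 * pi * of_int n * t))))\<^sup>2)
      + (\<Sum>n\<in>F. (cmod ((LINT t|unit_interval. v t * cis (- (2 * pi * of_int n * t))) - c n))\<^sup>2)"
proof -
  define e where "e n t = cis (2 * pi * of_int n * t)" for n :: int and t :: real
  define h where "h n = (LINT t|unit_interval. v t * cnj (e n t))" for n
  have [measurable]: "e n \<in> borel_measurable borel" for n
    unfolding e_def by (intro borel_measurable_continuous_onI continuous_intros)
  have cnj_e: "cnj (e n t) = cis (- (2 * pi * of_int n * t))" for n t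
    by (simp add: e_def cis_cnj)
  have M: "0 \<le> M" using bd[of 0] norm_ge_zero order_trans by blast
  have norm_e [simp]: "cmod (e n t) = 1" for n t
    by (simp add: e_def)
  have i1: "integrable unit_interval (\<lambda>t. v t * cnj (v t))"
    by (rule integrable_unit_interval_bounded[where B="M * M"])
       (auto simp: norm_mult intro!: mult_mono bd M)
  have i2: "integrable unit_interval (\<lambda>t. v t * cnj (e n t))" for n
    by (rule integrable_unit_interval_bounded[where B="M"]) (auto simp: norm_mult bd)
  have i3: "integrable unit_interval (\<lambda>t. cnj (v t) * e n t)" for n
    by (rule integrable_unit_interval_bounded[where B="M"]) (auto simp: norm_mult bd)
  have i4: "integrable unit_interval (\<lambda>t. e n t * cnj (e m t))" for n m
    by (rule integrable_unit_interval_bounded[where B="1"]) (auto simp: norm_mult)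
  have h': "(LINT t|unit_interval. cnj (v t) * e n t) = cnj (h n)" for n
    using Bochner_Integration.integral_cnj[of unit_interval "\<lambda>t. v t * cnj (e n t)"] by (simp add: h_def del: Bochner_Integration.integral_cnj)
  have orth: "(LINT t|unit_interval. e n t * cnj (e m t)) = (if n = m then 1 else 0)" for n m
  proof -
    have "e n t * cnj (e m t) = cis (2 * pi * of_int (n - m) * t)" for t
      by (simp add: e_def cis_cnj cis_mult algebra_simps)
    then show ?thesis
      using integral_unit_interval_cis[of "n - m"] by simp
  qed
  have norm2: "of_real ((cmod z)\<^sup>2) = z * cnj z" for z
    by (metis complex_norm_square)
  \<comment> \<open>The computation takes place in the complex numbers, where the squared modulus is
    z * cnj z and the expansion is sesquilinear; \<open>of_real\<close> is cancelled at the
    end.\<close>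
  have "of_real (LINT t|unit_interval. (cmod (v t - (\<Sum>n\<in>F. c n * e n t)))\<^sup>2) =
      (LINT t|unit_interval. v t * cnj (v t) - (\<Sum>n\<in>F. cnj (c n) * (v t * cnj (e n t)))
        - (\<Sum>n\<in>F. c n * (cnj (v t) * e n t)) + (\<Sum>n\<in>F. \<Sum>m\<in>F. c n * cnj (c m) * (e n t * cnj (e m t))))"
    unfolding integral_complex_of_real[symmetric] norm2
    by (intro Bochner_Integration.integral_cong refl)
       (simp add: algebra_simps sum_distrib_left sum_distrib_right sum_product, rule sum.swap)
  also have "\<dots> = (LINT t|unit_interval. v t * cnj (v t)) - (\<Sum>n\<in>F. cnj (c n) * h n)
        - (\<Sum>n\<in>F. c n * cnj (h n)) + (\<Sum>n\<in>F. \<Sum>m\<in>F. c n * cnj (c m) * (if n = m then 1 else 0))"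
    by (simp add: i1 i2 i3 i4 orth h' h_def[symmetric])
  also have "(\<Sum>n\<in>F. \<Sum>m\<in>F. c n * cnj (c m) * (if n = m then 1 else 0)) = (\<Sum>n\<in>F. c n * cnj (c n))"
    using \<open>finite F\<close> by (simp add: if_distrib[of "\<lambda>x. _ * x"] cong: if_cong)
  \<comment> \<open>Completing the square: the two mixed sums are absorbed into the products (h n -
    c n) * cnj (h n - c n).\<close>
  also have "(LINT t|unit_interval. v t * cnj (v t)) - (\<Sum>n\<in>F. cnj (c n) * h n)
        - (\<Sum>n\<in>F. c n * cnj (h n)) + (\<Sum>n\<in>F. c n * cnj (c n)) =
      (LINT t|unit_interval. v t * cnj (v t)) - (\<Sum>n\<in>F. h n * cnj (h n)) + (\<Sum>n\<in>F. (h n - c n) * cnj (h n - c n))"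
    by (simp add: algebra_simps sum.distrib sum_subtractf)
  also have "\<dots> = of_real ((LINT t|unit_interval. (cmod (v t))\<^sup>2) - (\<Sum>n\<in>F. (cmod (h n))\<^sup>2) + (\<Sum>n\<in>F. (cmod (h n - c n))\<^sup>2))"
    by (simp only: of_real_add of_real_diff of_real_sum norm2 integral_complex_of_real[symmetric])
  finally show ?thesis
    unfolding of_real_eq_iff by (simp add: h_def cnj_e) (simp add: e_def)
qed

text \<open>A Borel function is an almost everywhere limit of continuous functions. Clipping their
  values and forcing them to 0 at both ends makes them bounded loops; dominated convergence gives
  mean-square closeness to \<open>v\<close>, and a loop is uniformly close to a trigonometric
  polynomial.\<close>

lemma trig_poly_dense:
  fixes v :: "real \<Rightarrow> complex"
  assumes v[measurable]: "v \<in> borel_measurable borel" and bd: "\<And>t. cmod (v t) \<le> M" and "e > 0"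
  obtains p where "trig_poly p" "(LINT t|unit_interval. (cmod (v t - p t))\<^sup>2) < e"
proof -
  have M: "0 \<le> M" using bd[of 0] norm_ge_zero order_trans by blast
  have "v measurable_on UNIV"
    by (rule lebesgue_measurable_imp_measurable_on) (auto intro: measurable_completion)
  then obtain N g where N: "negligible N" and g: "\<And>n. continuous_on UNIV (g n)"
    and lim: "\<And>x. x \<notin> N \<Longrightarrow> (\<lambda>n. g n x) \<longlonglongrightarrow> v x"
    by (auto simp: measurable_on_def)
  \<comment> \<open>The projection onto the disc of radius \<open>M\<close> is continuous and fixes
    the values of \<open>v\<close>. It therefore preserves the limit while supplying the uniform
    bound for dominated convergence.\<close>
  define P where "P = closest_point (cball (0::complex) M)"
  have P: "continuous_on UNIV P" "\<And>z. cmod (P z) \<le> M" "\<And>z. cmod z \<le> M \<Longrightarrow> P z = z"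
    using M closest_point_in_set[of "cball 0 M"] unfolding P_def
    by (auto intro!: continuous_on_closest_point closest_point_self)
  \<comment> \<open>A continuous cutoff that vanishes at 0 and 1 and is eventually 1 at each
    interior point; the two endpoints form a null set.\<close>
  define cut where "cut n t = max 0 (min 1 (real n * (t * (1 - t))))" for n :: nat and t :: real
  have cut01: "0 \<le> cut n t" "cut n t \<le> 1" for n t by (auto simp: cut_def)
  have lim_cut: "(\<lambda>n. cut n t) \<longlonglongrightarrow> 1" if "0 < t" "t < 1" for t
  proof (rule tendsto_eventually)
    have "eventually (\<lambda>n. real n > 1 / (t * (1 - t))) sequentially"
      by (metis filterlim_at_top_dense filterlim_real_sequentially)
    then show "eventually (\<lambda>n. cut n t = 1) sequentially"
      by eventually_elim (use that in \<open>auto simp: cut_def field_simps\<close>)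
  qed
  define q where "q n t = cut n t *\<^sub>R P (g n t)" for n t
  have qc: "continuous_on UNIV (q n)" for n
    unfolding q_def cut_def
    by (intro continuous_intros continuous_on_compose2[OF P(1)] g) auto
  then have [measurable]: "q n \<in> borel_measurable borel" for n
    by (rule borel_measurable_continuous_onI)
  have qM: "cmod (q n t) \<le> M" for n t
    using cut01[of n t] P(2)[of "g n t"] M mult_mono[of "cut n t" 1 "cmod (P (g n t))" M] by (simp add: q_def)
  have "AE x in lborel. x \<notin> N"
    using N AE_not_in[of N lebesgue] unfolding AE_completion_iff negligible_iff_null_sets by blast
  moreover have "AE x in lborel. x \<noteq> 0" "AE x in lborel. x \<noteq> (1::real)"
    by (auto intro: AE_lborel_singleton)
  ultimately have ae: "AE t in unit_interval. (\<lambda>n. (cmod (v t - q n t))\<^sup>2) \<longlonglongrightarrow> 0"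
    unfolding AE_restrict_space_iff[of "{0..1::real}" lborel, simplified]
  proof eventually_elim
    case (elim t)
    have "(\<lambda>n. (cmod (v t - q n t))\<^sup>2) \<longlonglongrightarrow> 0" if "t \<in> {0..1}"
    proof -
      have t: "0 < t" "t < 1" using elim that by auto
      have "(\<lambda>n. P (g n t)) \<longlonglongrightarrow> P (v t)"
        using P(1) isCont_tendsto_compose[OF _ lim[OF elim(1)], of P] by (simp add: continuous_on_eq_continuous_at)
      then have "(\<lambda>n. q n t) \<longlonglongrightarrow> 1 *\<^sub>R v t"
        unfolding q_def using lim_cut[OF t] P(3)[OF bd] by (intro tendsto_scaleR) auto
      then have "(\<lambda>n. (cmod (v t - q n t))\<^sup>2) \<longlonglongrightarrow> (cmod (v t - 1 *\<^sub>R v t))\<^sup>2"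
        by (intro tendsto_intros)
      then show "(\<lambda>n. (cmod (v t - q n t))\<^sup>2) \<longlonglongrightarrow> 0" by simp
    qed
    then show ?case by simp
  qed
  have sq: "(cmod (v t - q n t))\<^sup>2 \<le> (M + M)\<^sup>2" for n t
    using norm_triangle_ineq4[of "v t" "q n t"] bd[of t] qM[of n t] by (intro power_mono) auto
  have "(\<lambda>n. LINT t|unit_interval. (cmod (v t - q n t))\<^sup>2) \<longlonglongrightarrow> (LINT t|unit_interval. 0)"
  proof (rule integral_dominated_convergence)
    show "integrable unit_interval (\<lambda>t. (M + M)\<^sup>2)"
      by (rule integrable_unit_interval_bounded) auto
  qed (use ae sq in \<open>auto intro!: borel_measurable_unit_interval\<close>)
  \<comment> \<open>The share e/4 is doubled by the estimate |x + y|^2 \<le> 2|x|^2 + 2|y|^2. The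
    uniform error \<open>sqrt (e / 4)\<close> below contributes the other e/2 in the same
    way.\<close>
  then have "eventually (\<lambda>n. (LINT t|unit_interval. (cmod (v t - q n t))\<^sup>2) < e / 4) sequentially"
    using \<open>e > 0\<close> by (intro order_tendstoD) auto
  then obtain n where n: "(LINT t|unit_interval. (cmod (v t - q n t))\<^sup>2) < e / 4"
    by (auto simp: eventually_sequentially)
  have "q n 0 = q n 1" by (simp add: q_def cut_def)
  then obtain p where p: "trig_poly p" "\<And>t. t \<in> {0..1} \<Longrightarrow> cmod (q n t - p t) < sqrt (e / 4)"
    using trig_poly_approx_loop[of "q n" "sqrt (e / 4)"] qc[of n] \<open>e > 0\<close>
    by (metis continuous_on_subset divide_pos_pos real_sqrt_gt_zero subset_UNIV zero_less_numeral)
  have i: "integrable unit_interval (\<lambda>t. (cmod (v t - q n t))\<^sup>2)"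
    by (rule integrable_unit_interval_bounded[where B="(M + M)\<^sup>2"]) (use sq in auto)
  have ic: "integrable unit_interval (\<lambda>t. e / 2)"
    by (rule integrable_unit_interval_bounded[where B="e / 2"]) (use \<open>e > 0\<close> in auto)
  have "(LINT t|unit_interval. (cmod (v t - p t))\<^sup>2) \<le> (LINT t|unit_interval. 2 * (cmod (v t - q n t))\<^sup>2 + e / 2)"
  proof (rule integral_mono_AE')
    show "integrable unit_interval (\<lambda>t. 2 * (cmod (v t - q n t))\<^sup>2 + e / 2)"
      by (intro Bochner_Integration.integrable_add integrable_mult_right i ic)
    show "AE t in unit_interval. (cmod (v t - p t))\<^sup>2 \<le> 2 * (cmod (v t - q n t))\<^sup>2 + e / 2"
    proof (rule AE_I2)
      fix t :: real assume "t \<in> space unit_interval"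
      then have "t \<in> {0..1}" by (simp add: space_restrict_space)
      then have "(cmod (q n t - p t))\<^sup>2 \<le> (sqrt (e / 4))\<^sup>2"
        using p(2) by (intro power_mono) (auto intro: less_imp_le)
      then have 1: "(cmod (q n t - p t))\<^sup>2 \<le> e / 4" using \<open>e > 0\<close> by simp
      have "cmod (v t - p t) \<le> cmod (v t - q n t) + cmod (q n t - p t)"
        using norm_triangle_ineq[of "v t - q n t" "q n t - p t"] by simp
      then have "(cmod (v t - p t))\<^sup>2 \<le> (cmod (v t - q n t) + cmod (q n t - p t))\<^sup>2"
        by (intro power_mono) auto
      also have "\<dots> \<le> 2 * (cmod (v t - q n t))\<^sup>2 + 2 * (cmod (q n t - p t))\<^sup>2"
        using zero_le_power2[of "cmod (v t - q n t) - cmod (q n t - p t)"]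
        by (simp add: power2_sum power2_diff)
      finally show "(cmod (v t - p t))\<^sup>2 \<le> 2 * (cmod (v t - q n t))\<^sup>2 + e / 2"
        using 1 by simp
    qed
  qed (use \<open>e > 0\<close> in \<open>auto intro!: AE_I2\<close>)
  also have "\<dots> = 2 * (LINT t|unit_interval. (cmod (v t - q n t))\<^sup>2) + e / 2"
    using i ic by (simp add: measure_restrict_space)
  also have "\<dots> < e" using n by simp
  finally show ?thesis
    using p(1) that by blast
qed

section \<open>Sums in [0, infinity] and Parseval's identity\<close>

lemma infsum_ennreal_eq_SUP:
  fixes f :: "'a \<Rightarrow> ennreal"
  shows "(\<Sum>\<^sub>\<infinity>i\<in>A. f i) = (SUP F\<in>{F. finite F \<and> F \<subseteq> A}. sum f F)"
proof (rule nonneg_infsum_complete)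
  show "0 \<le> f x" for x by (rule zero_le)
qed

lemma infsum_cmult_left_ennreal:
  fixes f :: "'a \<Rightarrow> ennreal"
  shows "(\<Sum>\<^sub>\<infinity>i\<in>A. c * f i) = c * (\<Sum>\<^sub>\<infinity>i\<in>A. f i)"
proof -
 have "c * (\<Sum>\<^sub>\<infinity>i\<in>A. f i) = (SUP F\<in>{F. finite F \<and> F \<subseteq> A}. c * sum f F)"
  unfolding infsum_ennreal_eq_SUP SUP_mult_left_ennreal ..
 also have "\<dots> = (SUP F\<in>{F. finite F \<and> F \<subseteq> A}. \<Sum>i\<in>F. c * f i)"
   unfolding sum_distrib_left ..
 also have "\<dots> = (\<Sum>\<^sub>\<infinity>i\<in>A. c * f i)" unfolding infsum_ennreal_eq_SUP ..
 finally show ?thesis ..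
qed

lemma parseval_unit_interval:
  fixes v :: "real \<Rightarrow> complex"
  assumes v: "v \<in> borel_measurable borel" and bd: "\<And>t. cmod (v t) \<le> M"
  shows "(\<Sum>\<^sub>\<infinity>n\<in>UNIV. ennreal ((cmod (LINT t|unit_interval. v t * cis (- (2 * pi * of_int n * t))))\<^sup>2)) =
    ennreal (LINT t|unit_interval. (cmod (v t))\<^sup>2)"
proof -
  define h where "h n = (LINT t|unit_interval. v t * cis (- (2 * pi * of_int n * t)))" for n :: int
  define V where "V = (LINT t|unit_interval. (cmod (v t))\<^sup>2)"
  have id: "0 \<le> V - (\<Sum>n\<in>F. (cmod (h n))\<^sup>2) + (\<Sum>n\<in>F. (cmod (h n - c n))\<^sup>2)" if "finite F" for F c
    using bessel_identity[OF v bd that, of c] Bochner_Integration.integral_nonneg[of unit_interval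
        "\<lambda>t. (cmod (v t - (\<Sum>n\<in>F. c n * cis (2 * pi * of_int n * t))))\<^sup>2"]
    unfolding V_def h_def by simp
  have "(SUP F\<in>{F. finite F \<and> F \<subseteq> UNIV}. \<Sum>n\<in>F. ennreal ((cmod (h n))\<^sup>2)) = ennreal V"
  proof (rule antisym)
    show "(SUP F\<in>{F. finite F \<and> F \<subseteq> UNIV}. \<Sum>n\<in>F. ennreal ((cmod (h n))\<^sup>2)) \<le> ennreal V"
    proof (rule SUP_least)
      \<comment> \<open>With \<open>c\<close> = \<open>h\<close> the last sum in Bessel's identity
        vanishes, which leaves Bessel's inequality.\<close>
      fix F :: "int set" assume "F \<in> {F. finite F \<and> F \<subseteq> UNIV}"
      then show "(\<Sum>n\<in>F. ennreal ((cmod (h n))\<^sup>2)) \<le> ennreal V"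
        using id[of F h] by (simp add: sum_ennreal ennreal_leI)
    qed
    show "ennreal V \<le> (SUP F\<in>{F. finite F \<and> F \<subseteq> UNIV}. \<Sum>n\<in>F. ennreal ((cmod (h n))\<^sup>2))" (is "_ \<le> ?R")
    proof (rule ennreal_le_epsilon)
      fix e :: real assume "0 < e"
      then obtain p where p: "trig_poly p" "(LINT t|unit_interval. (cmod (v t - p t))\<^sup>2) < e"
        using trig_poly_dense[OF v bd] by metis
      then obtain F c where F: "finite F" "p = (\<lambda>t. \<Sum>n\<in>F. c n * cis (2 * pi * of_int n * t))"
        using trig_poly_sum_form by blast
      \<comment> \<open>No choice of coefficients on \<open>F\<close> beats the Fourier
        coefficients: the last sum is nonnegative, so dropping it bounds the Bessel defect by the
        error of \<open>p\<close>.\<close>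
      have "V - (\<Sum>n\<in>F. (cmod (h n))\<^sup>2) + (\<Sum>n\<in>F. (cmod (h n - c n))\<^sup>2) < e"
        using p(2) bessel_identity[OF v bd F(1), of c] unfolding V_def h_def F(2) by simp
      moreover have "0 \<le> (\<Sum>n\<in>F. (cmod (h n - c n))\<^sup>2)"
        by (intro sum_nonneg) auto
      ultimately have "V \<le> (\<Sum>n\<in>F. (cmod (h n))\<^sup>2) + e" by simp
      then have "ennreal V \<le> ennreal (\<Sum>n\<in>F. (cmod (h n))\<^sup>2) + ennreal e"
        using \<open>0 < e\<close> by (simp add: sum_nonneg ennreal_leI flip: ennreal_plus)
      also have "ennreal (\<Sum>n\<in>F. (cmod (h n))\<^sup>2) = (\<Sum>n\<in>F. ennreal ((cmod (h n))\<^sup>2))"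
        by (simp add: sum_ennreal)
      also have "\<dots> \<le> ?R"
        by (rule SUP_upper) (use F in auto)
      finally show "ennreal V \<le> ?R + ennreal e"
        by (simp add: add_right_mono)
    qed
  qed
  then show ?thesis
    unfolding infsum_ennreal_eq_SUP h_def V_def .
qed

text \<open>Substitute t = a + T s. The shift costs each coefficient a unimodular factor and the
  dilation a factor \<open>T\<close>, so the left side gains T^2 while the squared norm gains only
  T. One \<open>T\<close> therefore remains on the right, the coefficients being
  unnormalised.\<close>

lemma parseval_interval:
  fixes u :: "real \<Rightarrow> complex"
  assumes u[measurable]: "u \<in> borel_measurable borel" and bd: "\<And>t. cmod (u t) \<le> M"
    and "T > 0" and supp: "\<And>t. t \<notin> {a..a + T} \<Longrightarrow> u t = 0"
  shows "(\<Sum>\<^sub>\<infinity>n\<in>UNIV. ennreal ((cmod (LINT t|lborel. u t * cis (- (2 * pi * of_int n * t / T))))\<^sup>2)) =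
    ennreal (T * (LINT t|lborel. (cmod (u t))\<^sup>2))"
proof -
  define v where "v s = u (a + T * s)" for s
  have v: "v \<in> borel_measurable borel" "\<And>t. cmod (v t) \<le> M"
    by (auto simp: v_def[abs_def] bd)
  \<comment> \<open>Stated for every \<open>F\<close> with F 0 = 0, so that it removes the indicator
    both from the coefficient integrals and from the squared norm.\<close>
  have ind: "indicator {0..1} s *\<^sub>R F (v s) = F (v s)" if "F 0 = 0" for s and F :: "complex \<Rightarrow> 'b::real_vector"
    using supp[of "a + T * s"] \<open>T > 0\<close> that by (auto simp: v_def indicator_def zero_le_mult_iff)
  have coeff: "(cmod (LINT t|lborel. u t * cis (- (2 * pi * of_int n * t / T))))\<^sup>2 =
      T\<^sup>2 * (cmod (LINT s|unit_interval. v s * cis (- (2 * pi * of_int n * s))))\<^sup>2" for n :: int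
  proof -
    have "(LINT t|lborel. u t * cis (- (2 * pi * of_int n * t / T))) =
        T *\<^sub>R (LINT s|lborel. u (a + T * s) * cis (- (2 * pi * of_int n * (a + T * s) / T)))"
      using \<open>T > 0\<close> by (subst lborel_integral_real_affine[where c=T and t=a]) auto
    also have "(LINT s|lborel. u (a + T * s) * cis (- (2 * pi * of_int n * (a + T * s) / T))) =
        (LINT s|lborel. cis (- (2 * pi * of_int n * a / T)) * (v s * cis (- (2 * pi * of_int n * s))))"
    proof (intro Bochner_Integration.integral_cong refl)
      fix s
      have "cis (- (2 * pi * of_int n * (a + T * s) / T)) =
          cis (- (2 * pi * of_int n * a / T)) * cis (- (2 * pi * of_int n * s))"
        using \<open>T > 0\<close> unfolding cis_mult by (intro arg_cong[where f=cis]) (simp add: field_simps)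
      then show "u (a + T * s) * cis (- (2 * pi * of_int n * (a + T * s) / T)) =
          cis (- (2 * pi * of_int n * a / T)) * (v s * cis (- (2 * pi * of_int n * s)))"
        by (simp add: v_def)
    qed
    also have "\<dots> = cis (- (2 * pi * of_int n * a / T)) * (LINT s|lborel. v s * cis (- (2 * pi * of_int n * s)))"
      by simp
    also have "(LINT s|lborel. v s * cis (- (2 * pi * of_int n * s))) =
        (LINT s|unit_interval. v s * cis (- (2 * pi * of_int n * s)))"
      unfolding integral_restrict_space[of "{0..1::real}" lborel, simplified]
      by (intro Bochner_Integration.integral_cong refl ind[symmetric, of "\<lambda>z. z * _"]) auto
    finally show ?thesis
      using \<open>T > 0\<close> by (simp add: norm_mult power_mult_distrib)
  qed
  have nrm: "(LINT t|lborel. (cmod (u t))\<^sup>2) = T * (LINT s|unit_interval. (cmod (v s))\<^sup>2)"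
  proof -
    have "(LINT t|lborel. (cmod (u t))\<^sup>2) = T * (LINT s|lborel. (cmod (v s))\<^sup>2)"
      unfolding v_def using \<open>T > 0\<close> by (subst lborel_integral_real_affine[where c=T and t=a]) auto
    also have "(LINT s|lborel. (cmod (v s))\<^sup>2) = (LINT s|unit_interval. (cmod (v s))\<^sup>2)"
      unfolding integral_restrict_space[of "{0..1::real}" lborel, simplified]
      by (intro Bochner_Integration.integral_cong refl ind[symmetric, of "\<lambda>z. (cmod z)\<^sup>2"]) auto
    finally show ?thesis .
  qed
  have "(\<Sum>\<^sub>\<infinity>n\<in>UNIV. ennreal ((cmod (LINT t|lborel. u t * cis (- (2 * pi * of_int n * t / T))))\<^sup>2)) =
     ennreal (T\<^sup>2) * ennreal (LINT s|unit_interval. (cmod (v s))\<^sup>2)"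
    unfolding coeff ennreal_mult'[OF zero_le_power2]
    unfolding parseval_unit_interval[OF v, symmetric] infsum_cmult_left_ennreal ..
  also have "\<dots> = ennreal (T * (LINT t|lborel. (cmod (u t))\<^sup>2))"
    unfolding nrm by (simp add: power2_eq_square mult.assoc flip: ennreal_mult')
  finally show ?thesis .
qed

section \<open>Cauchy sums over a fibre\<close>

lemma infsum_mono_ennreal:
  fixes f g :: "'a \<Rightarrow> ennreal"
  assumes "\<And>i. i \<in> A \<Longrightarrow> f i \<le> g i"
  shows "(\<Sum>\<^sub>\<infinity>i\<in>A. f i) \<le> (\<Sum>\<^sub>\<infinity>i\<in>A. g i)"
  by (intro infsum_mono nonneg_summable_on_complete assms zero_le)

text \<open>Centring the interval at 0 turns the difference of the endpoint exponentials into a pure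
  sine. A shift of \<open>u\<close> by k/\<beta> then changes the numerator only by a sign, so the
  numerator can be pulled out of a sum over \<open>k\<close>.\<close>

lemma integral_exp_symmetric_interval:
  fixes u :: complex and \<beta> :: real
  assumes "u \<noteq> 0" "0 < \<beta>"
  shows "(LINT x|lborel. indicator {-(\<beta>/2)..\<beta>/2} x *\<^sub>R exp (2 * of_real pi * \<i> * u * of_real x)) =
    sin (of_real (pi * \<beta>) * u) / (of_real pi * u)"
proof -
  let ?c = "2 * of_real pi * \<i> * u" and ?z = "of_real (pi * \<beta>) * u"
  have "(LINT x|lborel. indicator {-(\<beta>/2)..\<beta>/2} x *\<^sub>R exp (?c * of_real x)) =
      (exp (?c * of_real (\<beta>/2)) - exp (?c * of_real (-(\<beta>/2)))) / ?c"
    using assms by (intro integral_exp_atLeastAtMost) auto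
  also have "\<dots> = (exp (\<i> * ?z) - exp (- (\<i> * ?z))) / ?c"
    by (simp add: mult_ac)
  also have "\<dots> = sin ?z / (of_real pi * u)"
    using assms by (simp add: sin_exp_eq field_simps)
  finally show ?thesis .
qed

text \<open>The factor \<open>cos (pi * of_int k)\<close> is the sign (-1)^k, in a form that covers
  negative \<open>k\<close> as well.\<close>

lemma sin_add_int_pi:
  fixes z :: complex
  shows "sin (z + of_real (pi * of_int k)) = of_real (cos (pi * of_int k)) * sin z"
proof -
  have "sin (of_real (pi * of_int k) :: complex) = 0"
    unfolding sin_of_real by simp
  then show ?thesis
    unfolding sin_add cos_of_real by simp
qed

text \<open>Mapping the interval onto [0, 1] multiplies each coefficient by
  \<open>cis (- (pi * of_int k))\<close>, of modulus 1. Bessel's identity for the zero function then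
  evaluates the norm.\<close>

lemma integral_trig_sum_norm2:
  fixes a :: "int \<Rightarrow> complex"
  assumes "finite F" "0 < \<beta>"
  shows "(LINT x|lborel. indicator {-(\<beta>/2)..\<beta>/2} x *\<^sub>R
      (cmod (\<Sum>k\<in>F. a k * cis (2 * pi * x * of_int k / \<beta>)))\<^sup>2) = \<beta> * (\<Sum>k\<in>F. (cmod (a k))\<^sup>2)"
proof -
  define c where "c k = a k * cis (- (pi * of_int k))" for k
  have "(LINT x|lborel. indicator {-(\<beta>/2)..\<beta>/2} x *\<^sub>R
        (cmod (\<Sum>k\<in>F. a k * cis (2 * pi * x * of_int k / \<beta>)))\<^sup>2) =
      \<beta> * (LINT s|lborel. indicator {-(\<beta>/2)..\<beta>/2} (-(\<beta>/2) + \<beta> * s) *\<^sub>R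
        (cmod (\<Sum>k\<in>F. a k * cis (2 * pi * (-(\<beta>/2) + \<beta> * s) * of_int k / \<beta>)))\<^sup>2)"
    using \<open>0 < \<beta>\<close> by (subst lborel_integral_real_affine[where c=\<beta> and t="-(\<beta>/2)"]) auto
  also have "(LINT s|lborel. indicator {-(\<beta>/2)..\<beta>/2} (-(\<beta>/2) + \<beta> * s) *\<^sub>R
        (cmod (\<Sum>k\<in>F. a k * cis (2 * pi * (-(\<beta>/2) + \<beta> * s) * of_int k / \<beta>)))\<^sup>2) =
      (LINT s|lborel. indicator {0..1} s *\<^sub>R (cmod (\<Sum>k\<in>F. c k * cis (2 * pi * of_int k * s)))\<^sup>2)"
  proof (intro Bochner_Integration.integral_cong refl arg_cong2[where f=scaleR]
      arg_cong[where f="\<lambda>z. (cmod z)\<^sup>2"] sum.cong)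
    fix s :: real and k :: int
    show "indicator {-(\<beta>/2)..\<beta>/2} (-(\<beta>/2) + \<beta> * s) = (indicator {0..1} s :: real)"
      using \<open>0 < \<beta>\<close> by (auto simp: indicator_def zero_le_mult_iff)
    have "cis (2 * pi * (-(\<beta>/2) + \<beta> * s) * of_int k / \<beta>) = cis (- (pi * of_int k)) * cis (2 * pi * of_int k * s)"
      unfolding cis_mult using \<open>0 < \<beta>\<close> by (intro arg_cong[where f=cis]) (simp add: field_simps)
    then show "a k * cis (2 * pi * (-(\<beta>/2) + \<beta> * s) * of_int k / \<beta>) = c k * cis (2 * pi * of_int k * s)"
      by (simp add: c_def)
  qed
  also have "\<dots> = (LINT s|unit_interval. (cmod (\<Sum>k\<in>F. c k * cis (2 * pi * of_int k * s)))\<^sup>2)"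
    by (simp add: integral_restrict_space)
  also have "\<dots> = (\<Sum>k\<in>F. (cmod (c k))\<^sup>2)"
    using bessel_identity[of "\<lambda>_. 0" 0 F c] \<open>finite F\<close> by simp
  finally show ?thesis
    by (simp add: c_def norm_mult)
qed

text \<open>The squared modulus is (cosh 2y - cos 2x) / 2, which lies between sinh^2 y and cosh^2 y;
  these are the two fractions in \<open>E\<close>.\<close>

lemma norm_sin_squared_bounds:
  fixes x y :: real
  defines "E \<equiv> exp (2 * y)"
  shows "(E - 1)\<^sup>2 / (4 * E) \<le> (cmod (sin (of_real x + \<i> * of_real y)))\<^sup>2"
    and "(cmod (sin (of_real x + \<i> * of_real y)))\<^sup>2 \<le> (E + 1)\<^sup>2 / (4 * E)"
proof -
  have E: "E > 0" by (simp add: E_def)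
  have *: "(cmod (sin (of_real x + \<i> * of_real y)))\<^sup>2 = (E + 1 / E - 2 * cos (2 * x)) / 4"
    unfolding norm_sin_squared E_def by (simp add: inverse_eq_divide)
  have eq: "(E - 1)\<^sup>2 / (4 * E) = (E + 1 / E - 2) / 4" "(E + 1)\<^sup>2 / (4 * E) = (E + 1 / E + 2) / 4"
    using E by (simp_all add: field_simps power2_eq_square)
  show "(E - 1)\<^sup>2 / (4 * E) \<le> (cmod (sin (of_real x + \<i> * of_real y)))\<^sup>2"
    and "(cmod (sin (of_real x + \<i> * of_real y)))\<^sup>2 \<le> (E + 1)\<^sup>2 / (4 * E)"
    unfolding * eq using cos_le_one[of "2 * x"] cos_ge_minus_one[of "2 * x"]
    by (intro divide_right_mono; linarith)+
qed

text \<open>\<open>I\<close> is the squared norm of a function on [-\<beta>/2, \<beta>/2] whose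
  Fourier coefficients are the sine-weighted Cauchy sums. Only the weight exp(-4 pi w x) keeps it
  from being exactly \<beta> times the sum of the |a k|^2, and there this weight lies between 1/E
  and E.\<close>

lemma cauchy_fibre_identity:
  fixes a :: "int \<Rightarrow> complex" and w \<alpha> \<beta> t :: real
  assumes "w > 0" "\<alpha> > 0" "\<beta> > 0" "\<alpha> * \<beta> \<le> 1" "finite F"
  defines "E \<equiv> exp (2 * pi * \<beta> * w)"
  obtains I where
    "(\<Sum>\<^sub>\<infinity>m\<in>UNIV. ennreal ((cmod (sin (of_real (pi * \<beta> * (t - \<alpha> * of_int m)) + \<i> * of_real (pi * \<beta> * w)) / of_real pi *
        (\<Sum>k\<in>F. a k / (of_real (t + of_int k / \<beta> - \<alpha> * of_int m) + \<i> * of_real w))))\<^sup>2)) = ennreal (I / \<alpha>)"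
    "\<beta> / E * (\<Sum>k\<in>F. (cmod (a k))\<^sup>2) \<le> I" "I \<le> E * \<beta> * (\<Sum>k\<in>F. (cmod (a k))\<^sup>2)"
proof -
  \<comment> \<open>The sign (-1)^k built into the coefficients cancels the one that the sine
    acquires at index \<open>k\<close>; it leaves |a k| unchanged.\<close>
  define sg where "sg k = cos (pi * of_int k)" for k :: int
  have sg2: "sg k * sg k = 1" for k
    using sin_cos_squared_add[of "pi * of_int k"] by (simp add: sg_def power2_eq_square)
  have sg_abs: "\<bar>sg k\<bar> = 1" for k
    using sg2[of k] by (simp add: abs_square_eq_1 flip: power2_eq_square)
  define J where "J = {-(\<beta>/2)..\<beta>/2}"
  define u where "u k m = of_real (t + of_int k / \<beta> - \<alpha> * of_int m) + \<i> * of_real w" for k m :: int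
  define s where "s m = sin (of_real (pi * \<beta> * (t - \<alpha> * of_int m)) + \<i> * of_real (pi * \<beta> * w))" for m :: int
  define A where "A x = (\<Sum>k\<in>F. of_real (sg k) * a k * cis (2 * pi * x * of_int k / \<beta>))" for x
  \<comment> \<open>Chosen so that multiplying by the m-th character of period 1/\<alpha> turns each
    term of \<open>A\<close> into an exponential with frequency \<open>u k m\<close>; the factor
    exp(-2 pi w x) supplies the imaginary part of \<open>u k m\<close>.\<close>
  define \<psi> where "\<psi> x = indicator J x *\<^sub>R (of_real (exp (- (2 * pi * w * x))) * cis (2 * pi * t * x) * A x)" for x
  have [measurable]: "A \<in> borel_measurable borel"
    unfolding A_def[abs_def] using \<open>\<beta> > 0\<close>
    by (intro borel_measurable_continuous_onI continuous_intros) auto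
  have [measurable]: "J \<in> sets borel" by (simp add: J_def)
  have \<psi>_meas: "\<psi> \<in> borel_measurable borel"
    unfolding \<psi>_def[abs_def]
    by (intro borel_measurable_scaleR borel_measurable_times borel_measurable_indicator)
       (auto intro!: borel_measurable_continuous_onI continuous_intros)
  have u0: "u k m \<noteq> 0" for k m
    using \<open>w > 0\<close> by (auto simp: u_def complex_eq_iff)
  have A_bd: "cmod (A x) \<le> (\<Sum>k\<in>F. cmod (a k))" for x
    unfolding A_def by (rule order.trans[OF norm_sum]) (simp add: norm_mult sg_abs)
  have norm_\<psi>: "(cmod (\<psi> x))\<^sup>2 = indicator J x *\<^sub>R (exp (- (4 * pi * w * x)) * (cmod (A x))\<^sup>2)" for x
  proof -
    have "(exp (- (2 * pi * w * x)))\<^sup>2 = exp (- (4 * pi * w * x))"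
      by (simp flip: exp_of_nat_mult)
    then show ?thesis
      by (auto simp: \<psi>_def norm_mult power_mult_distrib indicator_def)
  qed
  have ex: "1 / E \<le> exp (- (4 * pi * w * x))" "exp (- (4 * pi * w * x)) \<le> E" if "x \<in> J" for x
  proof -
    have "\<bar>x\<bar> \<le> \<beta> / 2" using that by (auto simp: J_def)
    then have "4 * pi * w * \<bar>x\<bar> \<le> 4 * pi * w * (\<beta> / 2)"
      using \<open>w > 0\<close> by (intro mult_left_mono) auto
    moreover have "4 * pi * w * \<bar>x\<bar> = \<bar>4 * pi * w * x\<bar>"
      using \<open>w > 0\<close> by (simp add: abs_mult)
    moreover have "4 * pi * w * (\<beta> / 2) = 2 * pi * \<beta> * w" by simp
    ultimately have *: "\<bar>4 * pi * w * x\<bar> \<le> 2 * pi * \<beta> * w" by linarith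
    have "1 / E = exp (- (2 * pi * \<beta> * w))" by (simp add: E_def exp_minus inverse_eq_divide)
    then show "1 / E \<le> exp (- (4 * pi * w * x))" "exp (- (4 * pi * w * x)) \<le> E"
      using * by (simp_all add: E_def abs_le_iff)
  qed
  have E1: "E \<ge> 1" using assms by (simp add: E_def)
  have \<psi>_bd2: "(cmod (\<psi> x))\<^sup>2 \<le> E * (\<Sum>k\<in>F. cmod (a k))\<^sup>2" for x
    using ex(2)[of x] A_bd[of x] E1 unfolding norm_\<psi>
    by (auto simp: indicator_def intro!: mult_mono power_mono)
  have \<psi>_bd: "cmod (\<psi> x) \<le> sqrt (E * (\<Sum>k\<in>F. cmod (a k))\<^sup>2)" for x
    using \<psi>_bd2[of x] by (rule real_le_rsqrt)
  \<comment> \<open>Here \<alpha>\<beta> \<le> 1 enters: \<open>J\<close> fits into a single period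
    of length 1/\<alpha>, so Parseval's identity applies to \<open>\<psi>\<close> without
    overlap.\<close>
  have supp: "\<psi> x = 0" if "x \<notin> {- (1 / (2 * \<alpha>))..- (1 / (2 * \<alpha>)) + 1 / \<alpha>}" for x
  proof -
    have "\<beta> / 2 \<le> 1 / (2 * \<alpha>)" using assms by (simp add: field_simps)
    moreover have "- (1 / (2 * \<alpha>)) + 1 / \<alpha> = 1 / (2 * \<alpha>)" by (simp add: field_simps)
    ultimately have "x \<notin> J" using that by (auto simp: J_def)
    then show ?thesis by (simp add: \<psi>_def)
  qed
  have coeff: "(LINT x|lborel. \<psi> x * cis (- (2 * pi * of_int m * x / (1 / \<alpha>)))) =
      s m / of_real pi * (\<Sum>k\<in>F. a k / u k m)" for m
  proof -
    have "\<psi> x * cis (- (2 * pi * of_int m * x / (1 / \<alpha>))) =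
        (\<Sum>k\<in>F. of_real (sg k) * a k * (indicator J x *\<^sub>R exp (2 * of_real pi * \<i> * u k m * of_real x)))" for x
    proof -
      have "of_real (exp (- (2 * pi * w * x))) * cis (2 * pi * t * x) * cis (2 * pi * x * of_int k / \<beta>)
          * cis (- (2 * pi * of_int m * x / (1 / \<alpha>))) = exp (2 * of_real pi * \<i> * u k m * of_real x)" for k
        unfolding cis_conv_exp exp_of_real[symmetric] exp_add[symmetric] u_def
        by (intro arg_cong[where f=exp]) (simp add: complex_eq_iff algebra_simps)
      then show ?thesis
        unfolding \<psi>_def A_def
        by (auto simp: indicator_def sum_distrib_left sum_distrib_right mult_ac intro!: sum.cong)
    qed
    then have "(LINT x|lborel. \<psi> x * cis (- (2 * pi * of_int m * x / (1 / \<alpha>)))) =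
        (LINT x|lborel. (\<Sum>k\<in>F. of_real (sg k) * a k * (indicator J x *\<^sub>R exp (2 * of_real pi * \<i> * u k m * of_real x))))"
      by simp
    also have "\<dots> = (\<Sum>k\<in>F. LINT x|lborel. of_real (sg k) * a k * (indicator J x *\<^sub>R exp (2 * of_real pi * \<i> * u k m * of_real x)))"
      unfolding J_def
      by (intro Bochner_Integration.integral_sum integrable_mult_right borel_integrable_compact)
         (auto intro!: continuous_intros)
    also have "\<dots> = (\<Sum>k\<in>F. of_real (sg k) * a k * (sin (of_real (pi * \<beta>) * u k m) / (of_real pi * u k m)))"
      unfolding J_def Bochner_Integration.integral_mult_right_zero integral_exp_symmetric_interval[OF u0 \<open>\<beta> > 0\<close>] ..
    also have "\<dots> = (\<Sum>k\<in>F. s m / of_real pi * (a k / u k m))"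
    proof (intro sum.cong refl)
      fix k
      \<comment> \<open>The spacing 1/\<beta> of the fibre times pi \<beta> is pi, so each
        \<open>k\<close> shifts the argument of the sine by an exact multiple of pi.\<close>
      have "of_real (pi * \<beta>) * u k m =
          (of_real (pi * \<beta> * (t - \<alpha> * of_int m)) + \<i> * of_real (pi * \<beta> * w)) + of_real (pi * of_int k)"
        using \<open>\<beta> > 0\<close> by (simp add: u_def complex_eq_iff field_simps)
      then have "sin (of_real (pi * \<beta>) * u k m) = of_real (sg k) * s m"
        by (simp only: sin_add_int_pi sg_def s_def)
      then have "of_real (sg k) * a k * (sin (of_real (pi * \<beta>) * u k m) / (of_real pi * u k m)) =
         of_real (sg k * sg k) * (s m / of_real pi * (a k / u k m))"
        by simp
      then show "of_real (sg k) * a k * (sin (of_real (pi * \<beta>) * u k m) / (of_real pi * u k m)) =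
         s m / of_real pi * (a k / u k m)"
        by (simp add: sg2)
    qed
    finally show ?thesis by (simp only: sum_distrib_left)
  qed
  define I where "I = (LINT x|lborel. (cmod (\<psi> x))\<^sup>2)"
  have 1: "(\<Sum>\<^sub>\<infinity>m\<in>UNIV. ennreal ((cmod (s m / of_real pi * (\<Sum>k\<in>F. a k / u k m)))\<^sup>2)) = ennreal (I / \<alpha>)"
    using parseval_interval[of \<psi> _ "1 / \<alpha>" "- (1 / (2 * \<alpha>))", OF \<psi>_meas \<psi>_bd _ supp] \<open>\<alpha> > 0\<close>
    unfolding coeff I_def by simp
  have bi: "integrable lborel (\<lambda>x. indicator J x *\<^sub>R (c x * (cmod (A x))\<^sup>2))" if "continuous_on UNIV c" for c :: "real \<Rightarrow> real"
    unfolding J_def A_def using \<open>\<beta> > 0\<close>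
    by (intro borel_integrable_compact) (auto intro!: continuous_intros continuous_on_subset[OF that])
  have JA: "(LINT x|lborel. indicator J x *\<^sub>R (c * (cmod (A x))\<^sup>2)) = c * (\<beta> * (\<Sum>k\<in>F. (cmod (a k))\<^sup>2))" for c
  proof -
    have "(LINT x|lborel. indicator J x *\<^sub>R (c * (cmod (A x))\<^sup>2)) = c * (LINT x|lborel. indicator J x *\<^sub>R (cmod (A x))\<^sup>2)"
      unfolding integral_mult_right_zero[symmetric] by (simp add: mult_ac)
    also have "(LINT x|lborel. indicator J x *\<^sub>R (cmod (A x))\<^sup>2) = \<beta> * (\<Sum>k\<in>F. (cmod (of_real (sg k) * a k))\<^sup>2)"
      unfolding J_def A_def using assms(3,5) by (intro integral_trig_sum_norm2)
    finally show ?thesis by (simp add: norm_mult sg_abs)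
  qed
  have "(LINT x|lborel. indicator J x *\<^sub>R (1 / E * (cmod (A x))\<^sup>2)) \<le> I"
    unfolding I_def norm_\<psi>
    by (intro integral_mono bi continuous_intros)
       (auto simp: indicator_def simp del: times_divide_eq_left intro!: mult_right_mono ex(1))
  then have 2: "\<beta> / E * (\<Sum>k\<in>F. (cmod (a k))\<^sup>2) \<le> I"
    unfolding JA by simp
  have "I \<le> (LINT x|lborel. indicator J x *\<^sub>R (E * (cmod (A x))\<^sup>2))"
    unfolding I_def norm_\<psi>
    by (intro integral_mono bi continuous_intros) (auto simp: indicator_def intro!: mult_right_mono ex(2))
  then have 3: "I \<le> E * \<beta> * (\<Sum>k\<in>F. (cmod (a k))\<^sup>2)"
    unfolding JA by (simp add: mult.assoc)
  show ?thesis
    using that[OF 1[unfolded s_def u_def] 2 3] .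
qed

text \<open>Divide out the sine by its extreme moduli. In the lower bound the 1/E of the weight
  cancels the \<open>E\<close> in \<open>?lo\<close>; in the upper bound the two factors
  \<open>E\<close> multiply to E^2. This yields the constants 1/(E + 1)^2 and E^2/(E - 1)^2.\<close>

lemma cauchy_fibre_bounds:
  fixes a :: "int \<Rightarrow> complex" and w \<alpha> \<beta> t :: real
  assumes "w > 0" "\<alpha> > 0" "\<beta> > 0" "\<alpha> * \<beta> \<le> 1" "finite F"
  defines "E \<equiv> exp (2 * pi * \<beta> * w)"
  defines "S \<equiv> (\<Sum>\<^sub>\<infinity>m\<in>UNIV. ennreal ((cmod (\<Sum>k\<in>F. a k / (of_real (t + of_int k / \<beta> - \<alpha> * of_int m) + \<i> * of_real w)))\<^sup>2))"
  shows "ennreal (4 * pi\<^sup>2 / \<alpha> * (1 / (E + 1))\<^sup>2 * (\<beta> * (\<Sum>k\<in>F. (cmod (a k))\<^sup>2))) \<le> S"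
    and "S \<le> ennreal (4 * pi\<^sup>2 / \<alpha> * (E / (E - 1))\<^sup>2 * (\<beta> * (\<Sum>k\<in>F. (cmod (a k))\<^sup>2)))"
proof -
  define N where "N = (\<Sum>k\<in>F. (cmod (a k))\<^sup>2)"
  have N: "0 \<le> N" by (simp add: N_def sum_nonneg)
  define X where "X m = (\<Sum>k\<in>F. a k / (of_real (t + of_int k / \<beta> - \<alpha> * of_int m) + \<i> * of_real w))" for m :: int
  define s where "s m = sin (of_real (pi * \<beta> * (t - \<alpha> * of_int m)) + \<i> * of_real (pi * \<beta> * w))" for m :: int
  have "\<exists>I. (\<Sum>\<^sub>\<infinity>m\<in>UNIV. ennreal ((cmod (s m / of_real pi * X m))\<^sup>2)) = ennreal (I / \<alpha>) \<and>
      \<beta> / E * N \<le> I \<and> I \<le> E * \<beta> * N"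
    unfolding E_def X_def s_def N_def by (rule cauchy_fibre_identity[OF assms(1-5), of t a]) blast
  then obtain I where I: "(\<Sum>\<^sub>\<infinity>m\<in>UNIV. ennreal ((cmod (s m / of_real pi * X m))\<^sup>2)) = ennreal (I / \<alpha>)"
      "\<beta> / E * N \<le> I" "I \<le> E * \<beta> * N"
    by blast
  have E: "E > 1" using assms by (simp add: E_def)
  have s_bd: "(E - 1)\<^sup>2 / (4 * E) \<le> (cmod (s m))\<^sup>2" "(cmod (s m))\<^sup>2 \<le> (E + 1)\<^sup>2 / (4 * E)" for m
    using norm_sin_squared_bounds[where y="pi * \<beta> * w" and x="pi * \<beta> * (t - \<alpha> * of_int m)"]
    unfolding s_def E_def by (simp_all add: mult.assoc)
  have nrm: "(cmod (s m / of_real pi * X m))\<^sup>2 = (cmod (s m))\<^sup>2 / pi\<^sup>2 * (cmod (X m))\<^sup>2" for m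
    by (simp add: norm_mult norm_divide power_mult_distrib power_divide)
  \<comment> \<open>These are pi^2 divided by the upper and by the lower bound for the squared
    modulus of the sine.\<close>
  let ?lo = "4 * pi\<^sup>2 * E / (E + 1)\<^sup>2" and ?hi = "4 * pi\<^sup>2 * E / (E - 1)\<^sup>2"
  have lo: "?lo * (cmod (s m / of_real pi * X m))\<^sup>2 \<le> (cmod (X m))\<^sup>2" for m
  proof -
    have "?lo * ((cmod (s m))\<^sup>2 / pi\<^sup>2) \<le> ?lo * (((E + 1)\<^sup>2 / (4 * E)) / pi\<^sup>2)"
      using s_bd(2)[of m] E by (intro mult_left_mono divide_right_mono) auto
    also have "\<dots> = 1"
      using E by (simp add: field_simps)
    finally have "?lo * ((cmod (s m))\<^sup>2 / pi\<^sup>2) * (cmod (X m))\<^sup>2 \<le> 1 * (cmod (X m))\<^sup>2"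
      by (intro mult_right_mono) auto
    then show ?thesis
      unfolding nrm by (simp only: mult.assoc mult_1)
  qed
  have hi: "(cmod (X m))\<^sup>2 \<le> ?hi * (cmod (s m / of_real pi * X m))\<^sup>2" for m
  proof -
    have "1 = ?hi * (((E - 1)\<^sup>2 / (4 * E)) / pi\<^sup>2)"
      using E by (simp add: field_simps)
    also have "\<dots> \<le> ?hi * ((cmod (s m))\<^sup>2 / pi\<^sup>2)"
      using s_bd(1)[of m] E by (intro mult_left_mono divide_right_mono) auto
    finally have "1 * (cmod (X m))\<^sup>2 \<le> ?hi * ((cmod (s m))\<^sup>2 / pi\<^sup>2) * (cmod (X m))\<^sup>2"
      by (intro mult_right_mono) auto
    then show ?thesis
      unfolding nrm by (simp only: mult.assoc mult_1)
  qed
  have scale: "(\<Sum>\<^sub>\<infinity>m\<in>UNIV. ennreal (c * (cmod (s m / of_real pi * X m))\<^sup>2)) = ennreal (c * (I / \<alpha>))" if "0 \<le> c" for c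
    unfolding ennreal_mult'[OF that] infsum_cmult_left_ennreal I(1) ..
  have S: "S = (\<Sum>\<^sub>\<infinity>m\<in>UNIV. ennreal ((cmod (X m))\<^sup>2))"
    by (simp add: S_def X_def)
  have "4 * pi\<^sup>2 / \<alpha> * (1 / (E + 1))\<^sup>2 * (\<beta> * N) = ?lo * ((\<beta> / E * N) / \<alpha>)"
    using E by (simp add: power_divide field_simps)
  also have "\<dots> \<le> ?lo * (I / \<alpha>)"
    using I(2) E \<open>\<alpha> > 0\<close> by (intro mult_left_mono divide_right_mono) auto
  finally have "ennreal (4 * pi\<^sup>2 / \<alpha> * (1 / (E + 1))\<^sup>2 * (\<beta> * N)) \<le> ennreal (?lo * (I / \<alpha>))"
    by (rule ennreal_leI)
  also have "\<dots> = (\<Sum>\<^sub>\<infinity>m\<in>UNIV. ennreal (?lo * (cmod (s m / of_real pi * X m))\<^sup>2))"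
    using E by (intro scale[symmetric]) auto
  also have "\<dots> \<le> S"
    unfolding S by (intro infsum_mono_ennreal ennreal_leI lo)
  finally show "ennreal (4 * pi\<^sup>2 / \<alpha> * (1 / (E + 1))\<^sup>2 * (\<beta> * (\<Sum>k\<in>F. (cmod (a k))\<^sup>2))) \<le> S"
    unfolding N_def .
  have "S \<le> (\<Sum>\<^sub>\<infinity>m\<in>UNIV. ennreal (?hi * (cmod (s m / of_real pi * X m))\<^sup>2))"
    unfolding S by (intro infsum_mono_ennreal ennreal_leI hi)
  also have "\<dots> = ennreal (?hi * (I / \<alpha>))"
    using E by (intro scale) auto
  also have "\<dots> \<le> ennreal (?hi * ((E * \<beta> * N) / \<alpha>))"
    using I(3) E \<open>\<alpha> > 0\<close> by (intro ennreal_leI mult_left_mono divide_right_mono) auto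
  also have "?hi * ((E * \<beta> * N) / \<alpha>) = 4 * pi\<^sup>2 / \<alpha> * (E / (E - 1))\<^sup>2 * (\<beta> * N)"
    by (simp add: power_divide power2_eq_square mult_ac)
  finally show "S \<le> ennreal (4 * pi\<^sup>2 / \<alpha> * (E / (E - 1))\<^sup>2 * (\<beta> * (\<Sum>k\<in>F. (cmod (a k))\<^sup>2)))"
    unfolding N_def .
qed

section \<open>Reduction of the frame sum to fibres\<close>

text \<open>Viewing sums as integrals for counting measure makes Tonelli's theorem available for
  splitting the sum over pairs and for exchanging a sum with an integral. Infinitude gives a
  bijective enumeration by the natural numbers.\<close>

lemma infsum_eq_nn_integral_count_space:
  fixes f :: "'a::countable \<Rightarrow> ennreal"
  assumes "infinite (UNIV :: 'a set)"
  shows "(\<Sum>\<^sub>\<infinity>i\<in>UNIV. f i) = (\<integral>\<^sup>+i. f i \<partial>count_space UNIV)"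
  unfolding infsum_ennreal_eq_SUP
proof (rule antisym)
  show "(SUP F\<in>{F. finite F \<and> F \<subseteq> UNIV}. sum f F) \<le> (\<integral>\<^sup>+i. f i \<partial>count_space UNIV)"
  proof (rule SUP_least)
    fix F :: "'a set" assume "F \<in> {F. finite F \<and> F \<subseteq> UNIV}"
    then have "sum f F = (\<integral>\<^sup>+i. f i * indicator F i \<partial>count_space UNIV)"
      by (subst nn_integral_indicator_finite) auto
    also have "\<dots> \<le> (\<integral>\<^sup>+i. f i \<partial>count_space UNIV)"
      by (intro nn_integral_mono) (auto simp: indicator_def)
    finally show "sum f F \<le> (\<integral>\<^sup>+i. f i \<partial>count_space UNIV)" .
  qed
  let ?g = "from_nat_into (UNIV :: 'a set)"
  have g: "bij_betw ?g UNIV UNIV"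
    using bij_betw_from_nat_into[of "UNIV :: 'a set"] assms by simp
  have "(\<integral>\<^sup>+i. f i \<partial>count_space UNIV) = (SUP n. \<Sum>i<n. f (?g i))"
    unfolding nn_integral_bij_count_space[OF g, symmetric] nn_integral_count_space_nat suminf_eq_SUP ..
  also have "\<dots> \<le> (SUP F\<in>{F. finite F \<and> F \<subseteq> UNIV}. sum f F)"
  proof (rule SUP_least)
    fix n :: nat
    have "(\<Sum>i<n. f (?g i)) = sum f (?g ` {..<n})"
      using g by (subst sum.reindex) (auto simp: bij_betw_def intro: inj_on_subset)
    also have "\<dots> \<le> (SUP F\<in>{F. finite F \<and> F \<subseteq> UNIV}. sum f F)"
      by (rule SUP_upper) auto
    finally show "(\<Sum>i<n. f (?g i)) \<le> (SUP F\<in>{F. finite F \<and> F \<subseteq> UNIV}. sum f F)" .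
  qed
  finally show "(\<integral>\<^sup>+i. f i \<partial>count_space UNIV) \<le> (SUP F\<in>{F. finite F \<and> F \<subseteq> UNIV}. sum f F)" .
qed

text \<open>The half-open translates of {0..<T} partition the line, and the support meets only those
  with -K \<le> k < K. Hence the periodization is a finite sum.\<close>

lemma integral_periodization:
  fixes h :: "real \<Rightarrow> 'a::{banach, second_countable_topology}"
  assumes h: "integrable lborel h" and "0 < T"
    and supp: "\<And>t. t \<notin> {- (real K * T)..<real K * T} \<Longrightarrow> h t = 0"
  shows "(LINT t|lborel. h t) =
      (LINT t|lborel. indicator {0..<T} t *\<^sub>R (\<Sum>k\<in>{- int K..<int K}. h (t + of_int k * T)))"
proof -
  have shift: "(LINT t|lborel. indicator {0..<T} t *\<^sub>R h (t + of_int k * T)) =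
      (LINT s|lborel. indicator {0..<T} (s - of_int k * T) *\<^sub>R h s)" for k :: int
    by (subst lborel_integral_real_affine[where c=1 and t="of_int k * T" and f="\<lambda>s. indicator {0..<T} (s - of_int k * T) *\<^sub>R h s"])
       (simp_all add: add.commute)
  have int1: "integrable lborel (\<lambda>t. indicator {0..<T} t *\<^sub>R h (t + of_int k * T))" for k :: int
    using integrable_mult_indicator[OF _ lborel_integrable_real_affine[OF h, of 1 "of_int k * T"], of "{0..<T}"]
    by (simp add: add.commute)
  have int2: "integrable lborel (\<lambda>s. indicator {0..<T} (s - of_int k * T) *\<^sub>R h s)" for k :: int
    by (rule Bochner_Integration.integrable_bound[OF h])
       (use h in \<open>auto simp: indicator_def intro!: AE_I2\<close>)
  have part: "(\<Sum>k\<in>{- int K..<int K}. indicator {0..<T} (s - of_int k * T) *\<^sub>R h s) = h s" for s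
  proof (cases "s \<in> {- (real K * T)..<real K * T}")
    case False
    then show ?thesis by (simp add: supp)
  next
    case True
    \<comment> \<open>The floor of s/T is the unique index of the translate that contains
      \<open>s\<close>.\<close>
    define j where "j = \<lfloor>s / T\<rfloor>"
    have eq: "(s - of_int k * T \<in> {0..<T}) = (k = j)" for k :: int
    proof -
      have "(s - of_int k * T \<in> {0..<T}) = (of_int k \<le> s / T \<and> s / T < of_int k + 1)"
        using \<open>0 < T\<close> by (simp add: field_simps)
      also have "\<dots> = (k = j)"
        unfolding j_def using floor_eq_iff[of "s / T" k] by auto
      finally show ?thesis .
    qed
    have "- real K \<le> s / T" "s / T < real K"
      using True \<open>0 < T\<close> by (auto simp: field_simps)
    then have "j \<in> {- int K..<int K}"
      by (simp add: j_def le_floor_iff floor_less_iff)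
    moreover have "indicator {0..<T} (s - of_int k * T) *\<^sub>R h s = (if k = j then h s else 0)" for k :: int
      using eq[of k] by (simp add: indicator_def)
    ultimately show ?thesis by simp
  qed
  have "(LINT t|lborel. indicator {0..<T} t *\<^sub>R (\<Sum>k\<in>{- int K..<int K}. h (t + of_int k * T))) =
      (\<Sum>k\<in>{- int K..<int K}. LINT t|lborel. indicator {0..<T} t *\<^sub>R h (t + of_int k * T))"
    unfolding scaleR_sum_right by (intro Bochner_Integration.integral_sum int1)
  also have "\<dots> = (LINT s|lborel. (\<Sum>k\<in>{- int K..<int K}. indicator {0..<T} (s - of_int k * T) *\<^sub>R h s))"
    unfolding shift by (intro Bochner_Integration.integral_sum[symmetric] int2)
  also have "\<dots> = (LINT s|lborel. h s)"
    unfolding part ..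
  finally show ?thesis ..
qed

section \<open>Square integrability of the system and the fibre formula for the frame sum\<close>

lemma cauchy_kernel_L2:
  assumes "w > 0"
  shows "cauchy_kernel w \<in> L2"
proof -
  \<comment> \<open>Up to the constant 1/w^2 this is a dilation of the integrable function 1/(1 +
    x^2); the form \<open>0 + 1 / w * t\<close> fits the affine substitution rule.\<close>
  have nrm: "(cmod (cauchy_kernel w t))\<^sup>2 = inverse (1 + (0 + 1 / w * t)\<^sup>2) / w\<^sup>2" for t
  proof -
    have "(cmod (of_real t - \<i> * of_real w))\<^sup>2 = t\<^sup>2 + w\<^sup>2"
      by (simp add: cmod_power2)
    also have "\<dots> = w\<^sup>2 * (1 + (0 + 1 / w * t)\<^sup>2)"
      using assms by (simp add: power_divide distrib_left)
    finally show ?thesis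
      unfolding cauchy_kernel_def norm_divide power_divide by (simp add: divide_inverse mult_ac)
  qed
  have "integrable lborel (\<lambda>x::real. inverse (1 + x\<^sup>2))"
    using integrable_inverse_1_plus_square by (simp add: set_integrable_def einterval_def)
  then have "integrable lborel (\<lambda>t::real. inverse (1 + (0 + 1 / w * t)\<^sup>2))"
    by (rule lborel_integrable_real_affine) (use assms in simp)
  then have "integrable lborel (\<lambda>t. (cmod (cauchy_kernel w t))\<^sup>2)"
    unfolding nrm by (rule integrable_divide_zero)
  moreover have "cauchy_kernel w \<in> borel_measurable borel"
  proof (intro borel_measurable_continuous_onI)
    have "of_real t - \<i> * of_real w \<noteq> 0" for t
      using assms by (auto simp: complex_eq_iff)
    then show "continuous_on UNIV (cauchy_kernel w)"
      unfolding cauchy_kernel_def[abs_def] by (intro continuous_intros) auto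
  qed
  ultimately show ?thesis
    by (simp add: L2_def)
qed

lemma gabor_system_L2:
  assumes "g \<in> L2"
  shows "gabor_system g \<alpha> \<beta> mn \<in> L2"
proof (cases mn)
  case (Pair m n)
  have [measurable]: "g \<in> borel_measurable borel" using assms by (simp add: L2_def)
  have eq: "gabor_system g \<alpha> \<beta> (m, n) t = cis (2 * pi * \<beta> * of_int n * t) * g (- (\<alpha> * of_int m) + 1 * t)" for t
    by (simp add: gabor_system_def cis_conv_exp mult_ac)
  have "integrable lborel (\<lambda>t. (cmod (g (- (\<alpha> * of_int m) + 1 * t)))\<^sup>2)"
    using assms by (intro lborel_integrable_real_affine) (auto simp: L2_def)
  moreover have "(\<lambda>t. cis (2 * pi * \<beta> * of_int n * t)) \<in> borel_measurable borel"
    by (intro borel_measurable_continuous_onI continuous_intros)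
  ultimately show ?thesis
    unfolding Pair L2_def by (simp add: eq[abs_def] norm_mult)
qed

text \<open>For fixed \<open>m\<close> the inner products are the Fourier coefficients, for the
  period 1/\<beta>, of a periodized quotient. Parseval's identity removes the sum over
  \<open>n\<close>, and Tonelli's theorem moves the sum over \<open>m\<close> inside. Boundedness
  and bounded support make each periodization a bounded finite sum.\<close>

lemma frame_sum_cauchy_fibres:
  fixes f :: "real \<Rightarrow> complex"
  assumes "w > 0" "\<alpha> > 0" "\<beta> > 0" and f: "f \<in> L2" and bd: "\<And>t. cmod (f t) \<le> M"
    and supp: "\<And>t. t \<notin> {- (real K / \<beta>)..<real K / \<beta>} \<Longrightarrow> f t = 0"
  defines "F \<equiv> {- int K..<int K}"
  shows "frame_sum (gabor_system (cauchy_kernel w) \<alpha> \<beta>) f =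
    ennreal (1 / \<beta>) * (\<integral>\<^sup>+t. indicator {0..<1 / \<beta>} t * (\<Sum>\<^sub>\<infinity>m\<in>UNIV. ennreal ((cmod
      (\<Sum>k\<in>F. f (t + of_int k / \<beta>) / (of_real (t + of_int k / \<beta> - \<alpha> * of_int m) + \<i> * of_real w)))\<^sup>2)) \<partial>lborel)"
proof -
  define T where "T = 1 / \<beta>"
  have T: "T > 0" using \<open>\<beta> > 0\<close> by (simp add: T_def)
  have [measurable]: "f \<in> borel_measurable borel" using f by (simp add: L2_def)
  have M: "0 \<le> M" using bd[of 0] norm_ge_zero order_trans by blast
  \<comment> \<open>The second argument of the inner product is conjugated, which turns the
    denominator t - \<alpha>m - iw into t - \<alpha>m + iw.\<close>
  define d where "d m t = of_real (t - \<alpha> * of_int m) + \<i> * of_real w" for m :: int and t :: real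
  have d: "w \<le> cmod (d m t)" "d m t \<noteq> 0" for m t
    using abs_Im_le_cmod[of "d m t"] \<open>w > 0\<close> by (auto simp: d_def complex_eq_iff)
  have [measurable]: "d m \<in> borel_measurable borel" for m
    unfolding d_def[abs_def] by (intro borel_measurable_continuous_onI continuous_intros)
  define h where "h m t = f t / d m t" for m t
  have [measurable]: "h m \<in> borel_measurable borel" for m
    unfolding h_def[abs_def] by measurable
  have h_bd: "cmod (h m t) \<le> M / w" for m t
    unfolding h_def norm_divide using bd[of t] d(1)[of m t] M \<open>w > 0\<close> by (intro frac_le) auto
  have h_supp: "h m t = 0" if "t \<notin> {- (real K * T)..<real K * T}" for m t
    using supp[of t] that by (simp add: h_def T_def)
  define u where "u m t = indicator {0..<T} t *\<^sub>R (\<Sum>k\<in>F. h m (t + of_int k * T))" for m t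
  have u_meas [measurable]: "u m \<in> borel_measurable borel" for m
    unfolding u_def[abs_def] by measurable
  have u_bd: "cmod (u m t) \<le> real (card F) * (M / w)" for m t
  proof -
    have "cmod (u m t) \<le> cmod (\<Sum>k\<in>F. h m (t + of_int k * T))"
      by (simp add: u_def indicator_def)
    also have "\<dots> \<le> (\<Sum>k\<in>F. M / w)"
      by (rule order.trans[OF norm_sum]) (intro sum_mono h_bd)
    finally show ?thesis by simp
  qed
  have inner: "L2_inner f (gabor_system (cauchy_kernel w) \<alpha> \<beta> (m, n)) =
      (LINT t|lborel. u m t * cis (- (2 * pi * of_int n * t / T)))" for m n
  proof -
    define c where "c t = cis (- (2 * pi * of_int n * t / T))" for t
    have c_meas [measurable]: "c \<in> borel_measurable borel"
      unfolding c_def[abs_def] using T by (intro borel_measurable_continuous_onI continuous_intros) auto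
    have "f t * cnj (gabor_system (cauchy_kernel w) \<alpha> \<beta> (m, n) t) = h m t * c t" for t
      unfolding gabor_system_cauchy_kernel h_def d_def c_def T_def
      by (simp add: cis_conv_exp exp_cnj mult_ac)
    then have "L2_inner f (gabor_system (cauchy_kernel w) \<alpha> \<beta> (m, n)) = (LINT t|lborel. h m t * c t)"
      by (simp add: L2_inner_def)
    also have "\<dots> = (LINT t|lborel. indicator {0..<T} t *\<^sub>R
        (\<Sum>k\<in>F. h m (t + of_int k * T) * c (t + of_int k * T)))"
      unfolding F_def
    proof (rule integral_periodization[OF _ T])
      show "integrable lborel (\<lambda>t. h m t * c t)"
      proof (rule Bochner_Integration.integrable_bound)
        show "integrable lborel (\<lambda>t. indicator {- (real K * T)..real K * T} t *\<^sub>R (M / w))"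
          by (rule borel_integrable_compact) auto
        show "AE t in lborel. norm (h m t * c t) \<le> norm (indicator {- (real K * T)..real K * T} t *\<^sub>R (M / w))"
        proof (rule AE_I2)
          fix t
          show "norm (h m t * c t) \<le> norm (indicator {- (real K * T)..real K * T} t *\<^sub>R (M / w))"
            using h_bd[of m t] h_supp[of t m] M \<open>w > 0\<close>
            by (cases "t \<in> {- (real K * T)..<real K * T}") (auto simp: norm_mult c_def indicator_def)
        qed
      qed measurable
    qed (simp add: h_supp)
    also have "\<dots> = (LINT t|lborel. u m t * c t)"
    proof -
      \<comment> \<open>The modulation has period \<open>T\<close>, since n k is an integer, and so
        factors out of the sum over translates.\<close>
      have "c (t + of_int k * T) = c t" for t k
      proof -
        have "c (t + of_int k * T) = cis (- (2 * pi * of_int n * t / T)) * cis (2 * pi * of_int (- (n * k)))"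
          unfolding c_def cis_mult using T by (intro arg_cong[where f=cis]) (simp add: field_simps)
        also have "cis (2 * pi * of_int (- (n * k))) = 1"
          by (rule cis_multiple_2pi) auto
        finally show ?thesis by (simp add: c_def)
      qed
      then show ?thesis
        by (simp add: u_def sum_distrib_right)
    qed
    finally show ?thesis
      by (simp add: c_def)
  qed
  have u_int: "integrable lborel (\<lambda>t. (cmod (u m t))\<^sup>2)" for m
  proof (rule Bochner_Integration.integrable_bound)
    show "integrable lborel (\<lambda>t. indicator {0..T} t *\<^sub>R ((real (card F) * (M / w))\<^sup>2))"
      by (rule borel_integrable_compact) auto
    show "AE t in lborel. norm ((cmod (u m t))\<^sup>2) \<le> norm (indicator {0..T} t *\<^sub>R ((real (card F) * (M / w))\<^sup>2))"
    proof (rule AE_I2)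
      fix t
      have "(cmod (u m t))\<^sup>2 \<le> (real (card F) * (M / w))\<^sup>2"
        by (intro power_mono u_bd) auto
      moreover have "u m t = 0" if "t \<notin> {0..T}"
        using that by (auto simp: u_def indicator_def)
      ultimately show "norm ((cmod (u m t))\<^sup>2) \<le> norm (indicator {0..T} t *\<^sub>R ((real (card F) * (M / w))\<^sup>2))"
        by (cases "t \<in> {0..T}") auto
    qed
  qed measurable
  have row: "(\<Sum>\<^sub>\<infinity>n\<in>UNIV. ennreal ((cmod (L2_inner f (gabor_system (cauchy_kernel w) \<alpha> \<beta> (m, n))))\<^sup>2)) =
      ennreal T * (\<integral>\<^sup>+t. ennreal ((cmod (u m t))\<^sup>2) \<partial>lborel)" for m
  proof -
    have "(\<Sum>\<^sub>\<infinity>n\<in>UNIV. ennreal ((cmod (L2_inner f (gabor_system (cauchy_kernel w) \<alpha> \<beta> (m, n))))\<^sup>2)) =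
        ennreal (T * (LINT t|lborel. (cmod (u m t))\<^sup>2))"
      unfolding inner by (rule parseval_interval[where a=0, OF u_meas u_bd T]) (auto simp: u_def indicator_def)
    also have "\<dots> = ennreal T * (\<integral>\<^sup>+t. ennreal ((cmod (u m t))\<^sup>2) \<partial>lborel)"
      using T by (simp add: nn_integral_eq_integral u_int ennreal_mult')
    finally show ?thesis .
  qed
  have inf: "infinite (UNIV :: int set)" "infinite (UNIV :: (int \<times> int) set)"
    by (auto simp: infinite_UNIV_int finite_prod)
  have "frame_sum (gabor_system (cauchy_kernel w) \<alpha> \<beta>) f =
      (\<integral>\<^sup>+m. (\<Sum>\<^sub>\<infinity>n\<in>UNIV. ennreal ((cmod (L2_inner f (gabor_system (cauchy_kernel w) \<alpha> \<beta> (m, n))))\<^sup>2)) \<partial>count_space UNIV)"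
    unfolding frame_sum_def infsum_eq_nn_integral_count_space[OF inf(1)] infsum_eq_nn_integral_count_space[OF inf(2)]
    by (rule nn_integral_fst_count_space[symmetric])
  also have "\<dots> = ennreal T * (\<integral>\<^sup>+m. (\<integral>\<^sup>+t. ennreal ((cmod (u m t))\<^sup>2) \<partial>lborel) \<partial>count_space UNIV)"
    unfolding row by (rule nn_integral_cmult) simp
  also have "(\<integral>\<^sup>+m. (\<integral>\<^sup>+t. ennreal ((cmod (u m t))\<^sup>2) \<partial>lborel) \<partial>count_space UNIV) =
      (\<integral>\<^sup>+t. (\<integral>\<^sup>+m. ennreal ((cmod (u m t))\<^sup>2) \<partial>count_space UNIV) \<partial>lborel)"
    by (rule nn_integral_count_space_nn_integral[symmetric]) auto
  also have "\<dots> = (\<integral>\<^sup>+t. indicator {0..<1 / \<beta>} t * (\<Sum>\<^sub>\<infinity>m\<in>UNIV. ennreal ((cmod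
      (\<Sum>k\<in>F. f (t + of_int k / \<beta>) / (of_real (t + of_int k / \<beta> - \<alpha> * of_int m) + \<i> * of_real w)))\<^sup>2)) \<partial>lborel)"
  proof (intro nn_integral_cong)
    fix t
    show "(\<integral>\<^sup>+m. ennreal ((cmod (u m t))\<^sup>2) \<partial>count_space UNIV) =
      indicator {0..<1 / \<beta>} t * (\<Sum>\<^sub>\<infinity>m\<in>UNIV. ennreal ((cmod
      (\<Sum>k\<in>F. f (t + of_int k / \<beta>) / (of_real (t + of_int k / \<beta> - \<alpha> * of_int m) + \<i> * of_real w)))\<^sup>2))"
      unfolding infsum_eq_nn_integral_count_space[OF inf(1)]
      by (simp add: u_def h_def d_def T_def indicator_def)
  qed
  finally show ?thesis
    by (simp add: T_def)
qed

text \<open>Integrating the fibre norms over one period reassembles the norm of \<open>f\<close>;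
  the \<beta> from the fibre bounds cancels the 1/\<beta> from Parseval's identity. The constant
  \<open>c\<close> stands for either frame bound.\<close>

lemma nn_integral_fibre_norm:
  fixes f :: "real \<Rightarrow> complex"
  assumes "\<beta> > 0" and f: "f \<in> L2" and "0 \<le> c"
    and supp: "\<And>t. t \<notin> {- (real K / \<beta>)..<real K / \<beta>} \<Longrightarrow> f t = 0"
  shows "ennreal (1 / \<beta>) * (\<integral>\<^sup>+t. indicator {0..<1 / \<beta>} t *
      ennreal (c * (\<beta> * (\<Sum>k\<in>{- int K..<int K}. (cmod (f (t + of_int k / \<beta>)))\<^sup>2))) \<partial>lborel) =
    ennreal (c * (L2_norm f)\<^sup>2)"
proof -
  define S where "S t = (\<Sum>k\<in>{- int K..<int K}. (cmod (f (t + of_int k * (1 / \<beta>))))\<^sup>2)" for t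
  have S0: "0 \<le> S t" for t by (simp add: S_def sum_nonneg)
  have i: "integrable lborel (\<lambda>t. (cmod (f t))\<^sup>2)" using f by (simp add: L2_def)
  have eq: "(LINT t|lborel. (cmod (f t))\<^sup>2) = (LINT t|lborel. indicator {0..<1 / \<beta>} t *\<^sub>R S t)"
    unfolding S_def by (rule integral_periodization[OF i]) (use assms in auto)
  have "integrable lborel (\<lambda>t. (cmod (f (t + of_int k * (1 / \<beta>))))\<^sup>2)" for k :: int
    using lborel_integrable_real_affine[OF i, of 1 "of_int k * (1 / \<beta>)"] by (simp add: add.commute)
  then have iS: "integrable lborel (\<lambda>t. indicator {0..<1 / \<beta>} t *\<^sub>R S t)"
    unfolding S_def
    by (intro integrable_mult_indicator Bochner_Integration.integrable_sum) auto
  have "(\<integral>\<^sup>+t. indicator {0..<1 / \<beta>} t *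
      ennreal (c * (\<beta> * (\<Sum>k\<in>{- int K..<int K}. (cmod (f (t + of_int k / \<beta>)))\<^sup>2))) \<partial>lborel) =
      (\<integral>\<^sup>+t. ennreal (c * \<beta> * (indicator {0..<1 / \<beta>} t *\<^sub>R S t)) \<partial>lborel)"
    by (intro nn_integral_cong) (simp add: S_def indicator_def mult.assoc)
  also have "\<dots> = ennreal (LINT t|lborel. c * \<beta> * (indicator {0..<1 / \<beta>} t *\<^sub>R S t))"
    using assms S0 by (intro nn_integral_eq_integral integrable_mult_right iS) auto
  also have "\<dots> = ennreal (c * \<beta> * (L2_norm f)\<^sup>2)"
    unfolding Bochner_Integration.integral_mult_right_zero eq[symmetric]
    by (simp add: L2_norm_def Bochner_Integration.integral_nonneg)
  finally show ?thesis
    using \<open>\<beta> > 0\<close> by (simp flip: ennreal_mult')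
qed

section \<open>Frame bounds from bounded functions with bounded support\<close>

text \<open>Young's inequality 2xy \<le> e x^2 + y^2/e, applied term by term. The weight 1 + e on
  the main term can be brought arbitrarily close to 1, so no constant is lost when the other term
  tends to 0.\<close>

lemma frame_sum_add_le:
  assumes "e > 0" and lin: "\<And>i. L2_inner f (G i) = L2_inner g (G i) + L2_inner h (G i)"
  shows "frame_sum G f \<le> ennreal (1 + e) * frame_sum G g + ennreal (1 + 1 / e) * frame_sum G h"
proof -
  have young: "(cmod (a + b))\<^sup>2 \<le> (1 + e) * (cmod a)\<^sup>2 + (1 + 1 / e) * (cmod b)\<^sup>2" for a b
  proof -
    have "(cmod (a + b))\<^sup>2 \<le> (cmod a + cmod b)\<^sup>2"
      by (intro power_mono norm_triangle_ineq) simp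
    also have "\<dots> \<le> (1 + e) * (cmod a)\<^sup>2 + (1 + 1 / e) * (cmod b)\<^sup>2"
    proof -
      have "0 \<le> (e * cmod a - cmod b)\<^sup>2 / e" using \<open>e > 0\<close> by simp
      also have "\<dots> = e * (cmod a)\<^sup>2 + (cmod b)\<^sup>2 / e - 2 * cmod a * cmod b"
        using \<open>e > 0\<close> by (simp add: power2_diff field_simps power2_eq_square)
      finally show ?thesis by (simp add: power2_sum algebra_simps)
    qed
    finally show ?thesis .
  qed
  have "frame_sum G f \<le> (\<Sum>\<^sub>\<infinity>i\<in>UNIV. ennreal (1 + e) * ennreal ((cmod (L2_inner g (G i)))\<^sup>2) +
      ennreal (1 + 1 / e) * ennreal ((cmod (L2_inner h (G i)))\<^sup>2))"
    unfolding frame_sum_def lin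
  proof (intro infsum_mono_ennreal)
    fix i
    show "ennreal ((cmod (L2_inner g (G i) + L2_inner h (G i)))\<^sup>2) \<le>
      ennreal (1 + e) * ennreal ((cmod (L2_inner g (G i)))\<^sup>2) + ennreal (1 + 1 / e) * ennreal ((cmod (L2_inner h (G i)))\<^sup>2)"
      using young[of "L2_inner g (G i)" "L2_inner h (G i)"] \<open>e > 0\<close>
      by (simp add: ennreal_leI flip: ennreal_mult ennreal_plus)
  qed
  also have "\<dots> = (\<Sum>\<^sub>\<infinity>i\<in>UNIV. ennreal (1 + e) * ennreal ((cmod (L2_inner g (G i)))\<^sup>2)) +
      (\<Sum>\<^sub>\<infinity>i\<in>UNIV. ennreal (1 + 1 / e) * ennreal ((cmod (L2_inner h (G i)))\<^sup>2))"
    by (intro infsum_add nonneg_summable_on_complete zero_le)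
  finally show ?thesis
    unfolding frame_sum_def infsum_cmult_left_ennreal .
qed

lemma integrable_mult_L2:
  assumes "f \<in> L2" "g \<in> L2"
  shows "integrable lborel (\<lambda>t. f t * cnj (g t))"
proof (rule Bochner_Integration.integrable_bound)
  show "integrable lborel (\<lambda>t. (cmod (f t))\<^sup>2 + (cmod (g t))\<^sup>2)"
    using assms by (auto simp: L2_def)
  show "(\<lambda>t. f t * cnj (g t)) \<in> borel_measurable lborel"
    using assms by (auto simp: L2_def)
  have "cmod (f t * cnj (g t)) \<le> (cmod (f t))\<^sup>2 + (cmod (g t))\<^sup>2" for t
  proof -
    have "2 * cmod (f t) * cmod (g t) \<le> (cmod (f t))\<^sup>2 + (cmod (g t))\<^sup>2"
      by (rule sum_squares_bound)
    moreover have "0 \<le> cmod (f t) * cmod (g t)" by simp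
    ultimately show ?thesis unfolding norm_mult complex_mod_cnj by linarith
  qed
  then show "AE t in lborel. norm (f t * cnj (g t)) \<le> norm ((cmod (f t))\<^sup>2 + (cmod (g t))\<^sup>2)"
    by (intro AE_I2) simp
qed

text \<open>Truncate height and support by the same \<open>N\<close>. The upper bound passes to the
  limit in every finite partial sum. The lower bound needs the frame sum of the remainder to vanish,
  which is exactly what the upper bound, once known on all of \<open>L2\<close>, provides.\<close>

lemma frame_bounds_of_bounded_support:
  fixes G :: "'i \<Rightarrow> real \<Rightarrow> complex" and A B :: real
  assumes G: "\<And>i. G i \<in> L2" and "0 \<le> A" "0 \<le> B"
    and lower: "\<And>f N. f \<in> L2 \<Longrightarrow> (\<And>t. cmod (f t) \<le> real N) \<Longrightarrow> (\<And>t. real N < \<bar>t\<bar> \<Longrightarrow> f t = 0) \<Longrightarrow>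
      ennreal (A * (L2_norm f)\<^sup>2) \<le> frame_sum G f"
    and upper: "\<And>f N. f \<in> L2 \<Longrightarrow> (\<And>t. cmod (f t) \<le> real N) \<Longrightarrow> (\<And>t. real N < \<bar>t\<bar> \<Longrightarrow> f t = 0) \<Longrightarrow>
      frame_sum G f \<le> ennreal (B * (L2_norm f)\<^sup>2)"
  shows "lower_frame_bound G (ennreal A)" "upper_frame_bound G (ennreal B)"
proof -
  define cut where "cut N f t = (if cmod (f t) \<le> real N \<and> \<bar>t\<bar> \<le> real N then f t else 0)"
    for N :: nat and f :: "real \<Rightarrow> complex" and t :: real
  have norm_sq: "(L2_norm f)\<^sup>2 = (LINT t|lborel. (cmod (f t))\<^sup>2)" for f
    by (simp add: L2_norm_def Bochner_Integration.integral_nonneg)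
  have meas: "cut N f \<in> borel_measurable lborel" if "f \<in> L2" for N f
  proof -
    have [measurable]: "f \<in> borel_measurable borel" using that by (simp add: L2_def)
    show ?thesis unfolding cut_def[abs_def] by measurable
  qed
  have dom: "cmod (cut N f t) \<le> cmod (f t)" "cmod (f t - cut N f t) \<le> cmod (f t)" for N f t
    by (auto simp: cut_def)
  have L2_sub: "g \<in> L2" if "f \<in> L2" "g \<in> borel_measurable lborel" "\<And>t. cmod (g t) \<le> cmod (f t)" for f g
  proof -
    have "integrable lborel (\<lambda>t. (cmod (g t))\<^sup>2)"
    proof (rule Bochner_Integration.integrable_bound)
      show "integrable lborel (\<lambda>t. (cmod (f t))\<^sup>2)" using that by (simp add: L2_def)
      show "AE t in lborel. norm ((cmod (g t))\<^sup>2) \<le> norm ((cmod (f t))\<^sup>2)"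
        using that(3) by (intro AE_I2) (simp add: power_mono)
    qed (use that(2) in auto)
    then show ?thesis using that(2) by (simp add: L2_def)
  qed
  have cut_L2: "cut N f \<in> L2" if "f \<in> L2" for N f
    using L2_sub[OF that meas[OF that] dom(1)] .
  have rest_L2: "(\<lambda>t. f t - cut N f t) \<in> L2" if "f \<in> L2" for N f
  proof (rule L2_sub[OF that])
    show "(\<lambda>t. f t - cut N f t) \<in> borel_measurable lborel"
      using that meas[OF that, of N] by (auto simp: L2_def)
  qed (rule dom(2))
  \<comment> \<open>At each point the truncations are eventually equal to \<open>f\<close>, so all
    limits below hold pointwise and dominated convergence applies.\<close>
  have ev: "eventually (\<lambda>N. cut N f t = f t) sequentially" for f t
  proof -
    obtain N0 :: nat where "max (cmod (f t)) \<bar>t\<bar> \<le> real N0"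
      using real_arch_simple by blast
    then have "\<forall>N\<ge>N0. cut N f t = f t" by (auto simp: cut_def)
    then show ?thesis by (auto simp: eventually_sequentially)
  qed
  have inner_lim: "(\<lambda>N. L2_inner (cut N f) (G i)) \<longlonglongrightarrow> L2_inner f (G i)" if "f \<in> L2" for f i
    unfolding L2_inner_def
  proof (rule integral_dominated_convergence)
    show "integrable lborel (\<lambda>t. norm (f t * cnj (G i t)))"
      by (intro integrable_norm integrable_mult_L2 that G)
    show "AE t in lborel. (\<lambda>N. cut N f t * cnj (G i t)) \<longlonglongrightarrow> f t * cnj (G i t)"
      by (intro AE_I2 tendsto_intros tendsto_eventually ev)
    show "AE t in lborel. norm (cut N f t * cnj (G i t)) \<le> norm (f t * cnj (G i t))" for N
      by (intro AE_I2) (simp add: norm_mult mult_right_mono dom(1))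
  qed (intro borel_measurable_integrable integrable_mult_L2 that cut_L2 G)+
  have norm_lim: "(\<lambda>N. (L2_norm (cut N f))\<^sup>2) \<longlonglongrightarrow> (L2_norm f)\<^sup>2" if "f \<in> L2" for f
    unfolding norm_sq
  proof (rule integral_dominated_convergence)
    show "integrable lborel (\<lambda>t. (cmod (f t))\<^sup>2)" using that by (simp add: L2_def)
    show "AE t in lborel. (\<lambda>N. (cmod (cut N f t))\<^sup>2) \<longlonglongrightarrow> (cmod (f t))\<^sup>2"
      by (intro AE_I2 tendsto_intros tendsto_eventually ev)
    show "AE t in lborel. norm ((cmod (cut N f t))\<^sup>2) \<le> (cmod (f t))\<^sup>2" for N
      by (intro AE_I2) (simp add: power_mono dom(1))
  qed (use that meas[OF that] in \<open>auto simp: L2_def\<close>)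
  have rest_lim: "(\<lambda>N. (L2_norm (\<lambda>t. f t - cut N f t))\<^sup>2) \<longlonglongrightarrow> 0" if "f \<in> L2" for f
  proof -
    have "(\<lambda>N. LINT t|lborel. (cmod (f t - cut N f t))\<^sup>2) \<longlonglongrightarrow> (LINT t|lborel. (cmod (f t - f t))\<^sup>2)"
    proof (rule integral_dominated_convergence)
      show "integrable lborel (\<lambda>t. (cmod (f t))\<^sup>2)" using that by (simp add: L2_def)
      show "AE t in lborel. (\<lambda>N. (cmod (f t - cut N f t))\<^sup>2) \<longlonglongrightarrow> (cmod (f t - f t))\<^sup>2"
        by (intro AE_I2 tendsto_intros tendsto_eventually ev)
      show "AE t in lborel. norm ((cmod (f t - cut N f t))\<^sup>2) \<le> (cmod (f t))\<^sup>2" for N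
        by (intro AE_I2) (simp add: power_mono dom(2))
    qed (use that meas[OF that] in \<open>auto simp: L2_def\<close>)
    then show ?thesis unfolding norm_sq by simp
  qed
  have lin: "L2_inner (cut N f) (G i) = L2_inner f (G i) + L2_inner (\<lambda>t. cut N f t - f t) (G i)"
    and neg: "L2_inner (\<lambda>t. cut N f t - f t) (G i) = - L2_inner (\<lambda>t. f t - cut N f t) (G i)" if "f \<in> L2" for f N i
    using integrable_mult_L2[OF that G] integrable_mult_L2[OF cut_L2[OF that] G]
    by (simp_all add: L2_inner_def left_diff_distrib)
  have upper': "frame_sum G f \<le> ennreal (B * (L2_norm f)\<^sup>2)" if f: "f \<in> L2" for f
    unfolding frame_sum_def infsum_ennreal_eq_SUP
  proof (rule SUP_least)
    \<comment> \<open>On a finite index set the limit in \<open>N\<close> commutes with the sum; the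
      supremum over \<open>F\<close> is taken only afterwards.\<close>
    fix F :: "'i set" assume "F \<in> {F. finite F \<and> F \<subseteq> UNIV}"
    then have F: "finite F" by simp
    have "(\<Sum>i\<in>F. (cmod (L2_inner (cut N f) (G i)))\<^sup>2) \<le> B * (L2_norm (cut N f))\<^sup>2" for N
    proof -
      have "ennreal (\<Sum>i\<in>F. (cmod (L2_inner (cut N f) (G i)))\<^sup>2) =
          (\<Sum>i\<in>F. ennreal ((cmod (L2_inner (cut N f) (G i)))\<^sup>2))"
        by (simp add: sum_ennreal)
      also have "\<dots> \<le> frame_sum G (cut N f)"
        unfolding frame_sum_def infsum_ennreal_eq_SUP by (rule SUP_upper) (use F in auto)
      also have "\<dots> \<le> ennreal (B * (L2_norm (cut N f))\<^sup>2)"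
        by (rule upper[of _ N]) (use cut_L2[OF f] in \<open>auto simp: cut_def\<close>)
      finally show ?thesis
        using \<open>0 \<le> B\<close> by (simp add: ennreal_le_iff)
    qed
    moreover have "(\<lambda>N. \<Sum>i\<in>F. (cmod (L2_inner (cut N f) (G i)))\<^sup>2) \<longlonglongrightarrow> (\<Sum>i\<in>F. (cmod (L2_inner f (G i)))\<^sup>2)"
      by (intro tendsto_intros inner_lim f)
    moreover have "(\<lambda>N. B * (L2_norm (cut N f))\<^sup>2) \<longlonglongrightarrow> B * (L2_norm f)\<^sup>2"
      by (intro tendsto_intros norm_lim f)
    ultimately have "(\<Sum>i\<in>F. (cmod (L2_inner f (G i)))\<^sup>2) \<le> B * (L2_norm f)\<^sup>2"
      by (meson LIMSEQ_le)
    then show "(\<Sum>i\<in>F. ennreal ((cmod (L2_inner f (G i)))\<^sup>2)) \<le> ennreal (B * (L2_norm f)\<^sup>2)"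
      by (simp add: sum_ennreal ennreal_leI)
  qed
  then show "upper_frame_bound G (ennreal B)"
    unfolding upper_frame_bound_def using \<open>0 \<le> B\<close> by (simp add: ennreal_mult)
  show "lower_frame_bound G (ennreal A)"
    unfolding lower_frame_bound_def
  proof
    fix f assume f: "f \<in> L2"
    \<comment> \<open>The upper bound makes the frame sum finite, so the limits can be taken in the
      reals.\<close>
    obtain s where s: "frame_sum G f = ennreal s" "0 \<le> s"
      using upper'[OF f] by (cases "frame_sum G f") (auto simp: top_unique)
    define r where "r N = (L2_norm (\<lambda>t. f t - cut N f t))\<^sup>2" for N
    \<comment> \<open>Write the truncation as \<open>f\<close> plus an error. The bounded-support
      hypothesis handles the left side, and the upper bound controls the error through the squared
      norm \<open>r N\<close>.\<close>
    have 1: "A * (L2_norm (cut N f))\<^sup>2 \<le> (1 + e) * s + (1 + 1 / e) * (B * r N)" if "e > 0" for N e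
    proof -
      have "ennreal (A * (L2_norm (cut N f))\<^sup>2) \<le> frame_sum G (cut N f)"
        by (rule lower[of _ N]) (use cut_L2[OF f] in \<open>auto simp: cut_def\<close>)
      also have "\<dots> \<le> ennreal (1 + e) * frame_sum G f + ennreal (1 + 1 / e) * frame_sum G (\<lambda>t. cut N f t - f t)"
        by (rule frame_sum_add_le[OF that lin[OF f]])
      also have "frame_sum G (\<lambda>t. cut N f t - f t) = frame_sum G (\<lambda>t. f t - cut N f t)"
        unfolding frame_sum_def neg[OF f] by simp
      also have "\<dots> \<le> ennreal (B * r N)"
        unfolding r_def by (rule upper'[OF rest_L2[OF f]])
      finally have "ennreal (A * (L2_norm (cut N f))\<^sup>2) \<le> ennreal (1 + e) * ennreal s + ennreal (1 + 1 / e) * ennreal (B * r N)"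
        by (simp add: s(1) add_left_mono mult_left_mono)
      also have "\<dots> = ennreal ((1 + e) * s + (1 + 1 / e) * (B * r N))"
        using that s(2) \<open>0 \<le> B\<close> by (simp add: r_def ennreal_mult ennreal_plus)
      finally show ?thesis
        using that s(2) \<open>0 \<le> B\<close> by (subst (asm) ennreal_le_iff) (auto simp: r_def)
    qed
    have 2: "A * (L2_norm f)\<^sup>2 \<le> (1 + e) * s" if "e > 0" for e
    proof (rule LIMSEQ_le)
      show "(\<lambda>N. A * (L2_norm (cut N f))\<^sup>2) \<longlonglongrightarrow> A * (L2_norm f)\<^sup>2"
        by (intro tendsto_intros norm_lim f)
      have "(\<lambda>N. (1 + e) * s + (1 + 1 / e) * (B * r N)) \<longlonglongrightarrow> (1 + e) * s + (1 + 1 / e) * (B * 0)"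
        unfolding r_def by (intro tendsto_intros rest_lim f)
      then show "(\<lambda>N. (1 + e) * s + (1 + 1 / e) * (B * r N)) \<longlonglongrightarrow> (1 + e) * s" by simp
    qed (use 1[OF that] in auto)
    \<comment> \<open>The limit e to 0 is taken by setting e = 1/z - 1, so that 1 + e = 1/z for z in
      (0, 1).\<close>
    have "A * (L2_norm f)\<^sup>2 \<le> s"
    proof (rule field_le_mult_one_interval)
      fix z :: real assume z: "0 < z" "z < 1"
      then have "A * (L2_norm f)\<^sup>2 \<le> (1 / z) * s"
        using 2[of "1 / z - 1"] by simp
      then show "z * (A * (L2_norm f)\<^sup>2) \<le> s"
        using z by (simp add: field_simps)
    qed
    then show "ennreal A * ennreal ((L2_norm f)\<^sup>2) \<le> frame_sum G f"
      using \<open>0 \<le> A\<close> s by (simp add: ennreal_leI flip: ennreal_mult)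
  qed
qed

section \<open>Frame constants of the Cauchy kernel\<close>

theorem theorem1p1:
  fixes w \<alpha> \<beta> :: real
  assumes "w > 0" and "\<alpha> > 0" and "\<beta> > 0" and "\<alpha> * \<beta> \<le> 1"
  shows "optimal_lower_frame_const (gabor_system (cauchy_kernel w) \<alpha> \<beta>)
           \<ge> ennreal (4 * pi\<^sup>2 / \<alpha> * (1 / (exp (2 * pi * \<beta> * w) + 1))\<^sup>2)
       \<and> optimal_upper_frame_const (gabor_system (cauchy_kernel w) \<alpha> \<beta>)
           \<le> ennreal (4 * pi\<^sup>2 / \<alpha> *
               (exp (2 * pi * \<beta> * w) / (exp (2 * pi * \<beta> * w) - 1))\<^sup>2)"
proof -
  let ?G = "gabor_system (cauchy_kernel w) \<alpha> \<beta>"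
  define A where "A = 4 * pi\<^sup>2 / \<alpha> * (1 / (exp (2 * pi * \<beta> * w) + 1))\<^sup>2"
  define B where "B = 4 * pi\<^sup>2 / \<alpha> * (exp (2 * pi * \<beta> * w) / (exp (2 * pi * \<beta> * w) - 1))\<^sup>2"
  have AB: "0 \<le> A" "0 \<le> B" using \<open>\<alpha> > 0\<close> by (simp_all add: A_def B_def)
  have bounds: "ennreal (A * (L2_norm f)\<^sup>2) \<le> frame_sum ?G f \<and> frame_sum ?G f \<le> ennreal (B * (L2_norm f)\<^sup>2)"
    if f: "f \<in> L2" and bd: "\<And>t. cmod (f t) \<le> real N" and supp: "\<And>t. real N < \<bar>t\<bar> \<Longrightarrow> f t = 0" for f N
  proof -
    \<comment> \<open>The inequality is strict because \<open>f\<close> may be nonzero at t = N,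
      whereas the interval ending at K/\<beta> is open on the right.\<close>
    obtain K :: nat where K: "real N * \<beta> < real K"
      using reals_Archimedean2 by blast
    have supp': "f t = 0" if "t \<notin> {- (real K / \<beta>)..<real K / \<beta>}" for t
    proof (rule supp)
      have "real N < real K / \<beta>" using K \<open>\<beta> > 0\<close> by (simp add: field_simps)
      then show "real N < \<bar>t\<bar>" using that by auto
    qed
    define F where "F = {- int K..<int K}"
    define S where "S t = (\<Sum>\<^sub>\<infinity>m\<in>UNIV. ennreal ((cmod (\<Sum>k\<in>F. f (t + of_int k / \<beta>) /
        (of_real (t + of_int k / \<beta> - \<alpha> * of_int m) + \<i> * of_real w)))\<^sup>2))" for t
    define n where "n t = \<beta> * (\<Sum>k\<in>F. (cmod (f (t + of_int k / \<beta>)))\<^sup>2)" for t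
    have fibre: "ennreal (A * n t) \<le> S t" "S t \<le> ennreal (B * n t)" for t
      using cauchy_fibre_bounds[OF assms, of F "\<lambda>k. f (t + of_int k / \<beta>)" t]
      by (simp_all only: A_def B_def S_def n_def F_def finite_atLeastLessThan_int)
    have sum: "frame_sum ?G f = ennreal (1 / \<beta>) * (\<integral>\<^sup>+t. indicator {0..<1 / \<beta>} t * S t \<partial>lborel)"
      unfolding S_def F_def by (rule frame_sum_cauchy_fibres[OF assms(1-3) f bd supp'])
    have norm: "ennreal (1 / \<beta>) * (\<integral>\<^sup>+t. indicator {0..<1 / \<beta>} t * ennreal (c * n t) \<partial>lborel) =
        ennreal (c * (L2_norm f)\<^sup>2)" if "0 \<le> c" for c
      unfolding n_def F_def by (rule nn_integral_fibre_norm[OF \<open>\<beta> > 0\<close> f that supp'])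
    \<comment> \<open>Both A and B times the squared norm become integrals over the same period, so
      the claim reduces to the pointwise fibre bounds.\<close>
    show ?thesis
      unfolding sum norm[OF AB(1), symmetric] norm[OF AB(2), symmetric]
      by (intro conjI mult_left_mono nn_integral_mono fibre) auto
  qed
  have "lower_frame_bound ?G (ennreal A)" "upper_frame_bound ?G (ennreal B)"
    using frame_bounds_of_bounded_support[of ?G A B, OF gabor_system_L2[OF cauchy_kernel_L2[OF \<open>w > 0\<close>]] AB]
      bounds by blast+
  then show ?thesis
    unfolding optimal_lower_frame_const_def optimal_upper_frame_const_def A_def B_def
    by (auto intro: Sup_upper Inf_lower)
qed

end
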